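(* Let $X\subset\mathbb R^2$ be the closed triangle with vertices $A=(0,0)$, $B=(1,0)$, $C=(1/2,\sqrt3/2)$, with the Euclidean metric, and let $\mathcal F=\{f_A,f_B,f_C\}$ be the Levitt-Yoccoz gasket, i.e. the iterated function system on $X$ given by $$f_A(x,y)=\left(\frac{x}{x+y/\sqrt3+1},\frac{y}{x+y/\sqrt3+1}\right),\qquad f_B(x,y)=\left(\frac{y/\sqrt3+1}{-x+y/\sqrt3+2},\frac{y}{-x+y/\sqrt3+2}\right),$$ $$f_C(x,y)=\left(\frac{2y/\sqrt3-2x-1}{4(y/\sqrt3-1)},\frac{-\sqrt3}{4(y/\sqrt3-1)}\right).$$ Let $H_{\mathcal F}:\mathcal K(X)\to\mathcal K(X)$ be its Hutchinson map. Then: 1. $H_{\mathcal F}$ has a unique fixed point $K\in\mathcal K(X)$; 2. the global attractor of $H_{\mathcal F}$ and the chain-recurrent set of $H_{\mathcal F}$ are both equal to $\{K\}$; 3. the global attractor of $\mathcal F$ and the chain-recurrent set of $\mathcal F$ are both equal to $K$; 4. $K$ is chain-equivalent for $\mathcal F$, i.e. the whole chain-recurrent set of $\mathcal F$ is a single chain node. In particular, the chain graphs of $\mathcal F$ and of $H_{\mathcal F}$ have a single node and no edge.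
   Context: The maps $f_P$ ($P=A,B,C$) are, in the projective chart $z=1$ of $\mathbb{RP}^2$, the projective maps induced by the linear maps $\ell_P$ of $\mathbb R^3$ defined, with $e_A=(0,0,1)$, $e_B=(1,0,1)$, $e_C=(1/2,\sqrt3/2,1)$, by $\ell_A(e_A)=e_A$, $\ell_A(e_B)=e_A+e_B$, $\ell_A(e_C)=e_A+e_C$ and similarly for $\ell_B,\ell_C$; each $f_P$ maps $X$ into itself. An iterated function system (IFS) on a locally compact metric space $(Y,d_Y)$ is a finite collection $\mathcal F=\{f_1,\dots,f_m\}$, $m\ge1$, of continuous maps $f_i:Y\to Y$. For a finite word $I=i_1\dots i_k$ ($k\ge 0$) in the index set, $|I|=k$ and $\Phi^I_{\mathcal F}=f_{i_1}\circ\dots\circ f_{i_k}$ (the identity for the empty word). The orbit of $x$ is $\mathcal O_{\mathcal F}(x)=\{\Phi^I_{\mathcal F}(x): I \text{ a finite word}\}$, which contains $x$. A set $S\subset Y$ is $H$-invariant if $\bigcup_i f_i(S)=S$. With $N_\varepsilon(S)=\{y: d_Y(y,S)<\varepsilon\}$, $S$ attracts $L\subset Y$ if for every $\varepsilon>0$ there is $\tau>0$ such that $\Phi^I_{\mathcal F}(L)\subset N_\varepsilon(S)$ for every word $I$ with $|I|\ge\tau$. The global attractor of $\mathcal F$ is the (unique when it exists) non-empty compact $H$-invariant subset of $Y$ that attracts every compact subset of $Y$. Chains. For $\varepsilon>0$, an $\varepsilon$-chain from $x$ to $y$ is a finite sequence $x=x_0,x_1,\dots,x_k=y$ of points of $Y$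 ($k\ge 0$) together with indices $i_0,\dots,i_{k-1}$ such that $d_Y(f_{i_n}(x_n),x_{n+1})<\varepsilon$ for $n=0,\dots,k-1$. The point $y$ is downstream from $x$ if for every $\varepsilon>0$ there is an $\varepsilon$-chain from $x$ to $y$. Two points are chain-equivalent if each is downstream from the other; a set is chain-equivalent if any two of its points are. The chain-recurrent set is the set of $x\in Y$ such that $x$ is chain-equivalent to $z$ for every $z\in\mathcal O_{\mathcal F}(x)$. Chain-equivalence is an equivalence relation on the chain-recurrent set; its equivalence classes are the chain nodes. The chain graph is the directed graph having the chain nodes as its nodes, with an edge from a node $M$ to a distinct node $N$ when some point of $N$ is downstream from some point of $M$. Hutchinson map. $\mathcal K(X)$ is the space of all non-empty compact subsets of $X$, with the Hausdorff metric $d_H$. $H_{\mathcal F}:\mathcal K(X)\to\mathcal K(X)$ is $H_{\mathcal F}(L)=\bigcup_i f_i(L)$, regarded as an IFS with a single map on $(\mathcal K(X),d_H)$; its global attractor, chain-recurrent set and chain graph are those of this one-map IFS. *)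

theory Defs
  imports "HOL-Analysis.Analysis" "Graph_Theory.Pair_Digraph"
begin

section \<open>Iterated function systems on a metric space\<close>

text \<open>
  The ambient space is an abstract metric space \<open>m\<close> with carrier \<open>mspace m\<close>, so that the
  same definitions apply to a subset of the plane and to its space of compact subsets. The maps are
  total functions, of which only the values on \<open>mspace m\<close> matter. An iterated function system
  is given by the finite set of its maps, and each map serves as its own index: words are lists
  over this set.
\<close>

definition ifs :: "'a metric \<Rightarrow> ('a \<Rightarrow> 'a) set \<Rightarrow> bool" where
  "ifs m F \<longleftrightarrow> locally_compact_space (mtopology_of m) \<and> finite F \<and> F \<noteq> {} \<and>
     (\<forall>f\<in>F. continuous_map (mtopology_of m) (mtopology_of m) f)"

definition word_map :: "('a \<Rightarrow> 'a) list \<Rightarrow> 'a \<Rightarrow> 'a" where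
  "word_map w = foldr (\<circ>) w id"

definition orbit_of :: "('a \<Rightarrow> 'a) set \<Rightarrow> 'a \<Rightarrow> 'a set" where
  "orbit_of F x = {word_map w x | w. w \<in> lists F}"

definition hutchinson :: "('a \<Rightarrow> 'a) set \<Rightarrow> 'a set \<Rightarrow> 'a set" where
  "hutchinson F L = (\<Union>f\<in>F. f ` L)"

definition H_invariant :: "'a metric \<Rightarrow> ('a \<Rightarrow> 'a) set \<Rightarrow> 'a set \<Rightarrow> bool" where
  "H_invariant m F S \<longleftrightarrow> S \<subseteq> mspace m \<and> hutchinson F S = S"

text \<open>
  The distance \<open>d(y,S)\<close> is an infimum over \<open>S\<close>, so it is less than \<open>\<epsilon>\<close> iff some
  point of \<open>S\<close> is at distance less than \<open>\<epsilon>\<close> from \<open>y\<close> (for \<open>S\<close> empty: with the convention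
  that the infimum is infinite).
\<close>

definition nbhd_of :: "'a metric \<Rightarrow> real \<Rightarrow> 'a set \<Rightarrow> 'a set" where
  "nbhd_of m \<epsilon> S = {y \<in> mspace m. \<exists>s\<in>S. mdist m y s < \<epsilon>}"

definition attracts :: "'a metric \<Rightarrow> ('a \<Rightarrow> 'a) set \<Rightarrow> 'a set \<Rightarrow> 'a set \<Rightarrow> bool" where
  "attracts m F S L \<longleftrightarrow>
     (\<forall>\<epsilon>>0. \<exists>\<tau>>0. \<forall>w\<in>lists F. length w \<ge> \<tau> \<longrightarrow> word_map w ` L \<subseteq> nbhd_of m \<epsilon> S)"

definition global_attractor :: "'a metric \<Rightarrow> ('a \<Rightarrow> 'a) set \<Rightarrow> 'a set \<Rightarrow> bool" where
  "global_attractor m F S \<longleftrightarrow>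
     S \<noteq> {} \<and> compactin (mtopology_of m) S \<and> H_invariant m F S \<and>
     (\<forall>L. compactin (mtopology_of m) L \<longrightarrow> attracts m F S L)"


section \<open>Chains\<close>

definition eps_chain :: "'a metric \<Rightarrow> ('a \<Rightarrow> 'a) set \<Rightarrow> real \<Rightarrow> 'a \<Rightarrow> 'a \<Rightarrow> bool" where
  "eps_chain m F \<epsilon> x y \<longleftrightarrow>
     (\<exists>(k::nat) p g. p 0 = x \<and> p k = y \<and> (\<forall>n\<le>k. p n \<in> mspace m) \<and>
        (\<forall>n<k. g n \<in> F \<and> mdist m (g n (p n)) (p (Suc n)) < \<epsilon>))"

text \<open>\<open>downstream m F x y\<close> says that \<open>y\<close> is downstream from \<open>x\<close>.\<close>

definition downstream :: "'a metric \<Rightarrow> ('a \<Rightarrow> 'a) set \<Rightarrow> 'a \<Rightarrow> 'a \<Rightarrow> bool" where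
  "downstream m F x y \<longleftrightarrow> (\<forall>\<epsilon>>0. eps_chain m F \<epsilon> x y)"

definition chain_equivalent :: "'a metric \<Rightarrow> ('a \<Rightarrow> 'a) set \<Rightarrow> 'a \<Rightarrow> 'a \<Rightarrow> bool" where
  "chain_equivalent m F x y \<longleftrightarrow> downstream m F x y \<and> downstream m F y x"

definition chain_equivalent_set :: "'a metric \<Rightarrow> ('a \<Rightarrow> 'a) set \<Rightarrow> 'a set \<Rightarrow> bool" where
  "chain_equivalent_set m F S \<longleftrightarrow> (\<forall>x\<in>S. \<forall>y\<in>S. chain_equivalent m F x y)"

definition chain_recurrent_set :: "'a metric \<Rightarrow> ('a \<Rightarrow> 'a) set \<Rightarrow> 'a set" where
  "chain_recurrent_set m F = {x \<in> mspace m. \<forall>z\<in>orbit_of F x. chain_equivalent m F x z}"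

definition chain_nodes :: "'a metric \<Rightarrow> ('a \<Rightarrow> 'a) set \<Rightarrow> 'a set set" where
  "chain_nodes m F = chain_recurrent_set m F //
     {(x, y). x \<in> chain_recurrent_set m F \<and> y \<in> chain_recurrent_set m F \<and>
              chain_equivalent m F x y}"

definition chain_graph :: "'a metric \<Rightarrow> ('a \<Rightarrow> 'a) set \<Rightarrow> 'a set pair_pre_digraph" where
  "chain_graph m F =
     \<lparr>pverts = chain_nodes m F,
      parcs = {(M, N). M \<in> chain_nodes m F \<and> N \<in> chain_nodes m F \<and> M \<noteq> N \<and>
                 (\<exists>x\<in>M. \<exists>y\<in>N. downstream m F x y)}\<rparr>"


section \<open>The space of compact subsets\<close>

definition compacts :: "'a metric \<Rightarrow> 'a set set" where
  "compacts m = {L. L \<noteq> {} \<and> compactin (mtopology_of m) L}"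

definition hausdorff_dist :: "'a metric \<Rightarrow> 'a set \<Rightarrow> 'a set \<Rightarrow> real" where
  "hausdorff_dist m A B =
     max (SUP a\<in>A. INF b\<in>B. mdist m a b) (SUP b\<in>B. INF a\<in>A. mdist m a b)"

text \<open>
  The type \<open>metric\<close> requires a distance that is symmetric and nonnegative on the whole type,
  hence the value 0 outside the carrier.
\<close>

definition hausdorff_metric :: "'a metric \<Rightarrow> 'a set metric" where
  "hausdorff_metric m =
     metric (compacts m,
       \<lambda>A B. if A \<in> compacts m \<and> B \<in> compacts m then hausdorff_dist m A B else 0)"

lemma compacts_subset: "A \<in> compacts m \<Longrightarrow> A \<subseteq> mspace m"
  using compactin_subset_topspace by (fastforce simp: compacts_def)

lemma compacts_mdist_attained:
  assumes "B \<in> compacts m" "a \<in> mspace m"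
  shows "\<exists>b\<in>B. \<forall>c\<in>B. mdist m a b \<le> mdist m a c"
proof -
  have "continuous_map (mtopology_of m) euclidean (mdist m a)"
    using assms(2) by (rule continuous_on_mdist)
  then have "compactin euclidean (mdist m a ` B)"
    using assms(1) image_compactin by (fastforce simp: compacts_def)
  then have "compact (mdist m a ` B)" "mdist m a ` B \<noteq> {}"
    using assms(1) by (auto simp: compacts_def)
  then show ?thesis
    using compact_attains_inf by fastforce
qed

lemma INF_mdist_le_iff:
  assumes "B \<in> compacts m" "a \<in> mspace m"
  shows "(INF b\<in>B. mdist m a b) \<le> r \<longleftrightarrow> (\<exists>b\<in>B. mdist m a b \<le> r)"
proof -
  obtain b where b: "b \<in> B" "\<And>c. c \<in> B \<Longrightarrow> mdist m a b \<le> mdist m a c"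
    using compacts_mdist_attained[OF assms] by blast
  have "(INF b\<in>B. mdist m a b) = mdist m a b"
    using b by (intro cInf_eq_minimum) auto
  then show ?thesis
    using b order_trans by force
qed

lemma compacts_mdist_bounded:
  assumes "A \<in> compacts m" "B \<in> compacts m"
  shows "\<exists>r. \<forall>a\<in>A. \<forall>b\<in>B. mdist m a b \<le> r"
proof -
  interpret M: Metric_space "mspace m" "mdist m"
    by (rule Metric_space_mspace_mdist)
  have "compactin M.mtopology (A \<union> B)"
    using assms by (auto simp: compacts_def mtopology_of_def compactin_Un)
  then have "M.mbounded (A \<union> B)"
    by (rule M.compactin_imp_mbounded)
  then show ?thesis
    unfolding M.mbounded_alt by blast
qed

lemma hausdorff_dist_le_iff:
  assumes A: "A \<in> compacts m" and B: "B \<in> compacts m"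
  shows "hausdorff_dist m A B \<le> r \<longleftrightarrow>
    (\<forall>a\<in>A. \<exists>b\<in>B. mdist m a b \<le> r) \<and> (\<forall>b\<in>B. \<exists>a\<in>A. mdist m a b \<le> r)"
proof -
  have *: "(SUP a\<in>A. INF b\<in>B. mdist m a b) \<le> r \<longleftrightarrow> (\<forall>a\<in>A. \<exists>b\<in>B. mdist m a b \<le> r)"
    if A: "A \<in> compacts m" and B: "B \<in> compacts m" for A B
  proof -
    obtain R where R: "\<And>a b. a \<in> A \<Longrightarrow> b \<in> B \<Longrightarrow> mdist m a b \<le> R"
      using compacts_mdist_bounded[OF A B] by blast
    have ne: "A \<noteq> {}" "B \<noteq> {}"
      using A B by (auto simp: compacts_def)
    have sub: "a \<in> mspace m" if "a \<in> A" for a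
      using that compacts_subset[OF A] by blast
    have "bdd_above ((\<lambda>a. INF b\<in>B. mdist m a b) ` A)"
      using R ne INF_mdist_le_iff[OF B sub] by (intro bdd_aboveI2[where M = R]) blast
    then have "(SUP a\<in>A. INF b\<in>B. mdist m a b) \<le> r \<longleftrightarrow> (\<forall>a\<in>A. (INF b\<in>B. mdist m a b) \<le> r)"
      using ne by (intro cSUP_le_iff)
    then show ?thesis
      using INF_mdist_le_iff[OF B sub] by simp
  qed
  have "mdist m a b = mdist m b a" for a b
    by (simp add: mdist_commute)
  then show ?thesis
    unfolding hausdorff_dist_def using *[OF A B] *[OF B A] by simp
qed

lemma Metric_space_hausdorff:
  "Metric_space (compacts m)
     (\<lambda>A B. if A \<in> compacts m \<and> B \<in> compacts m then hausdorff_dist m A B else 0)"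
proof -
  interpret M: Metric_space "mspace m" "mdist m"
    by (rule Metric_space_mspace_mdist)
  have nonneg: "0 \<le> hausdorff_dist m A B" if A: "A \<in> compacts m" and B: "B \<in> compacts m" for A B
  proof -
    obtain a where "a \<in> A"
      using A by (auto simp: compacts_def)
    then obtain b where "mdist m a b \<le> hausdorff_dist m A B"
      using hausdorff_dist_le_iff[OF A B] by blast
    then show ?thesis
      using M.nonneg order_trans by blast
  qed
  have commute: "hausdorff_dist m A B = hausdorff_dist m B A" for A B
    unfolding hausdorff_dist_def by (simp add: max.commute mdist_commute)
  have sub: "A \<subseteq> B" if A: "A \<in> compacts m" and B: "B \<in> compacts m"
    and 0: "hausdorff_dist m A B = 0" for A B
  proof
    fix a assume a: "a \<in> A"
    then obtain b where b: "b \<in> B" "mdist m a b \<le> 0"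
      using hausdorff_dist_le_iff[OF A B, of 0] 0 by auto
    then have "mdist m a b = 0"
      using M.nonneg[of a b] by linarith
    then have "a = b"
      using a b compacts_subset[OF A] compacts_subset[OF B] M.zero by blast
    then show "a \<in> B"
      using b by simp
  qed
  have zero: "hausdorff_dist m A B = 0 \<longleftrightarrow> A = B"
    if A: "A \<in> compacts m" and B: "B \<in> compacts m" for A B
  proof
    assume "hausdorff_dist m A B = 0"
    then show "A = B"
      using sub[OF A B] sub[OF B A] commute by auto
  next
    assume "A = B"
    moreover have "hausdorff_dist m A A \<le> 0"
      using hausdorff_dist_le_iff[OF A A] compacts_subset[OF A] M.mdist_zero by (metis order_refl subsetD)
    ultimately show "hausdorff_dist m A B = 0"
      using nonneg[OF A B] by simp
  qed
  have triangle: "hausdorff_dist m A C \<le> hausdorff_dist m A B + hausdorff_dist m B C"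
    if A: "A \<in> compacts m" and B: "B \<in> compacts m" and C: "C \<in> compacts m" for A B C
  proof -
    have tri: "mdist m a c \<le> hausdorff_dist m A B + hausdorff_dist m B C"
      if "a \<in> A" "b \<in> B" "c \<in> C" "mdist m a b \<le> hausdorff_dist m A B"
        "mdist m b c \<le> hausdorff_dist m B C" for a b c
    proof -
      have "a \<in> mspace m" "b \<in> mspace m" "c \<in> mspace m"
        using that compacts_subset[OF A] compacts_subset[OF B] compacts_subset[OF C] by auto
      then show ?thesis
        using M.triangle[of a b c] that by linarith
    qed
    show ?thesis
      unfolding hausdorff_dist_le_iff[OF A C]
      using tri hausdorff_dist_le_iff[OF A B, of "hausdorff_dist m A B"]
        hausdorff_dist_le_iff[OF B C, of "hausdorff_dist m B C"]
      by (smt (verit, best))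
  qed
  show ?thesis
    by unfold_locales (use nonneg commute zero triangle in auto)
qed

lemma mspace_hausdorff_metric [simp]: "mspace (hausdorff_metric m) = compacts m"
  unfolding hausdorff_metric_def
  by (rule Metric_space.mspace_metric[OF Metric_space_hausdorff])

lemma mdist_hausdorff_metric:
  "A \<in> compacts m \<Longrightarrow> B \<in> compacts m \<Longrightarrow> mdist (hausdorff_metric m) A B = hausdorff_dist m A B"
  unfolding hausdorff_metric_def
  by (simp add: Metric_space.mdist_metric[OF Metric_space_hausdorff])


text \<open>
  Over a compact space the Hutchinson map is again an iterated function system, on the space of
  compact subsets.
\<close>

lemma compact_space_hausdorff_metric:
  assumes "compact_space (mtopology_of m)"
  shows "compact_space (mtopology_of (hausdorff_metric m))"
proof -
  interpret M: Metric_space "mspace m" "mdist m"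
    by (rule Metric_space_mspace_mdist)
  interpret H: Metric_space "compacts m" "mdist (hausdorff_metric m)"
    using Metric_space_mspace_mdist[of "hausdorff_metric m"] by simp
  have top: "mtopology_of m = M.mtopology" "mtopology_of (hausdorff_metric m) = H.mtopology"
    by (simp_all add: mtopology_of_def)
  have le_iff: "mdist (hausdorff_metric m) A B \<le> r \<longleftrightarrow>
      (\<forall>a\<in>A. \<exists>b\<in>B. mdist m a b \<le> r) \<and> (\<forall>b\<in>B. \<exists>a\<in>A. mdist m a b \<le> r)"
    if "A \<in> compacts m" "B \<in> compacts m" for A B r
    using that by (simp add: mdist_hausdorff_metric hausdorff_dist_le_iff)
  have cpt: "compact_space M.mtopology"
    using assms by (simp add: top)
  have "H.mtotally_bounded (compacts m)"
    unfolding H.mtotally_bounded_def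
  proof (intro allI impI)
    fix \<epsilon> :: real assume "\<epsilon> > 0"
    then have "\<epsilon> / 2 > 0"
      by simp
    moreover have "M.mtotally_bounded (mspace m)"
      using cpt by (simp add: M.compact_space_eq_mcomplete_mtotally_bounded)
    ultimately have "\<exists>N. finite N \<and> N \<subseteq> mspace m \<and> mspace m \<subseteq> (\<Union>x\<in>N. M.mball x (\<epsilon> / 2))"
      by (simp only: M.mtotally_bounded_def)
    then obtain N where N: "finite N" "N \<subseteq> mspace m" "mspace m \<subseteq> (\<Union>x\<in>N. M.mball x (\<epsilon> / 2))"
      by (elim exE conjE)
    let ?\<N> = "{S. S \<subseteq> N \<and> S \<noteq> {}}"
    have sub: "?\<N> \<subseteq> compacts m"
      using N(1,2) by (auto simp: compacts_def top intro!: finite_imp_compactin intro: finite_subset)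
    have "A \<in> (\<Union>S\<in>?\<N>. H.mball S \<epsilon>)" if A: "A \<in> compacts m" for A
    proof -
      define S where "S = {x \<in> N. \<exists>a\<in>A. mdist m x a < \<epsilon> / 2}"
      have cover: "\<exists>x\<in>S. mdist m x a \<le> \<epsilon> / 2" if "a \<in> A" for a
      proof -
        have "a \<in> (\<Union>x\<in>N. M.mball x (\<epsilon> / 2))"
          using N(3) compacts_subset[OF A] that by blast
        then obtain x where "x \<in> N" "mdist m x a < \<epsilon> / 2"
          by auto
        then show ?thesis
          using that unfolding S_def by force
      qed
      then have "S \<in> ?\<N>"
        using A unfolding S_def compacts_def by fastforce
      moreover have "mdist (hausdorff_metric m) S A \<le> \<epsilon> / 2"
        using \<open>S \<in> ?\<N>\<close> sub A cover by (subst le_iff) (auto simp: S_def intro: less_imp_le)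
      ultimately have "A \<in> H.mball S \<epsilon>"
        using sub A \<open>\<epsilon> > 0\<close> unfolding H.in_mball by auto
      with \<open>S \<in> ?\<N>\<close> show ?thesis
        by (rule UN_I)
    qed
    moreover have "finite ?\<N>"
      using N(1) by simp
    ultimately show "\<exists>K. finite K \<and> K \<subseteq> compacts m \<and> compacts m \<subseteq> (\<Union>x\<in>K. H.mball x \<epsilon>)"
      using sub by blast
  qed
  moreover have "H.mcomplete"
    unfolding H.mcomplete_def
  proof (intro allI impI)
    fix \<sigma> assume \<sigma>: "H.MCauchy \<sigma>"
    then have \<sigma>_in: "\<sigma> n \<in> compacts m" for n
      unfolding H.MCauchy_def by blast
    have \<sigma>_sub: "a \<in> mspace m" if "a \<in> \<sigma> n" for a n
      using that compacts_subset[OF \<sigma>_in] by blast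
    define L where "L = {x \<in> mspace m. \<forall>\<epsilon>>0. \<forall>N. \<exists>n\<ge>N. \<exists>a\<in>\<sigma> n. mdist m x a < \<epsilon>}"
    have near: "\<exists>x\<in>L. mdist m a x \<le> 2 * \<epsilon>"
      if \<epsilon>: "\<epsilon> > 0" and N: "\<And>k l. k \<ge> N \<Longrightarrow> l \<ge> N \<Longrightarrow> mdist (hausdorff_metric m) (\<sigma> k) (\<sigma> l) < \<epsilon>"
        and n: "n \<ge> N" and a: "a \<in> \<sigma> n" for \<epsilon> N n a
    proof -
      have "\<exists>b\<in>\<sigma> (n + k). mdist m a b \<le> \<epsilon>" for k
        using N[of n "n + k"] n a le_iff[OF \<sigma>_in \<sigma>_in, of n "n + k" \<epsilon>] by auto
      then obtain b where b: "\<And>k. b k \<in> \<sigma> (n + k)" "\<And>k. mdist m a (b k) \<le> \<epsilon>"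
        by metis
      have "compactin M.mtopology (mspace m)"
        using cpt by (simp add: compact_space_def)
      moreover have "range b \<subseteq> mspace m"
        using b(1) \<sigma>_sub by blast
      ultimately obtain x r where x: "x \<in> mspace m" and r: "strict_mono (r :: nat \<Rightarrow> nat)"
        and lim: "limitin M.mtopology (b \<circ> r) x sequentially"
        unfolding M.compactin_sequentially by blast
      have ev: "\<exists>K. \<forall>k\<ge>K. mdist m (b (r k)) x < \<delta>" if "\<delta> > 0" for \<delta>
        using lim that unfolding M.limit_metric_sequentially o_def by meson
      have "x \<in> L"
        unfolding L_def
      proof (intro CollectI conjI allI impI x)
        fix \<delta> :: real and N' :: nat assume "\<delta> > 0"
        then obtain K where K: "\<And>k. k \<ge> K \<Longrightarrow> mdist m (b (r k)) x < \<delta>"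
          using ev by blast
        let ?k = "max K N'"
        have "n + r ?k \<ge> N'"
          using seq_suble[OF r, of ?k] by linarith
        moreover have "mdist m x (b (r ?k)) < \<delta>"
          using K[of ?k] by (simp add: M.commute)
        ultimately show "\<exists>n\<ge>N'. \<exists>a\<in>\<sigma> n. mdist m x a < \<delta>"
          using b(1) by blast
      qed
      moreover have "mdist m a x \<le> 2 * \<epsilon>"
      proof -
        obtain K where K: "\<And>k. k \<ge> K \<Longrightarrow> mdist m (b (r k)) x < \<epsilon>"
          using ev \<epsilon> by blast
        have "mdist m a x \<le> mdist m a (b (r K)) + mdist m (b (r K)) x"
          using x a b(1) \<sigma>_sub by (intro M.triangle) blast+
        then show ?thesis
          using K[of K] b(2)[of "r K"] by simp
      qed
      ultimately show ?thesis
        by blast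
    qed
    have Cauchy: "\<exists>N. \<forall>k l. k \<ge> N \<longrightarrow> l \<ge> N \<longrightarrow> mdist (hausdorff_metric m) (\<sigma> k) (\<sigma> l) < \<epsilon>"
      if "\<epsilon> > 0" for \<epsilon>
      using \<sigma> that unfolding H.MCauchy_def by blast
    have "L \<noteq> {}"
    proof -
      obtain N where N: "\<And>k l. k \<ge> N \<Longrightarrow> l \<ge> N \<Longrightarrow> mdist (hausdorff_metric m) (\<sigma> k) (\<sigma> l) < 1"
        using Cauchy[of 1] by auto
      obtain a where "a \<in> \<sigma> N"
        using \<sigma>_in[of N] by (auto simp: compacts_def)
      then show ?thesis
        using near[OF zero_less_one N order_refl] by blast
    qed
    moreover have "closedin M.mtopology L"
      unfolding M.metric_closedin_iff_sequentially_closed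
    proof (intro conjI allI impI)
      show "L \<subseteq> mspace m"
        by (auto simp: L_def)
      fix p x assume p: "range p \<subseteq> L \<and> limitin M.mtopology p x sequentially"
      then have x: "x \<in> mspace m"
        by (auto simp: M.limit_metric_sequentially)
      show "x \<in> L"
        unfolding L_def
      proof (intro CollectI conjI allI impI x)
        fix \<epsilon> :: real and N :: nat assume "\<epsilon> > 0"
        then have \<epsilon>: "\<epsilon> / 2 > 0"
          by simp
        then obtain k where k: "mdist m (p k) x < \<epsilon> / 2"
          using p unfolding M.limit_metric_sequentially by blast
        have "p k \<in> L"
          using p by blast
        then obtain n a where n: "n \<ge> N" "a \<in> \<sigma> n" "mdist m (p k) a < \<epsilon> / 2"
          using \<epsilon> unfolding L_def by blast
        have "mdist m x a \<le> mdist m (p k) x + mdist m (p k) a"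
          using x \<sigma>_sub[OF n(2)] \<open>p k \<in> L\<close> M.triangle''[of x "p k" a] by (auto simp: L_def)
        then show "\<exists>n\<ge>N. \<exists>a\<in>\<sigma> n. mdist m x a < \<epsilon>"
          using n k by (intro exI[of _ n] conjI bexI[of _ a]) linarith+
      qed
    qed
    ultimately have L: "L \<in> compacts m"
      using cpt by (simp add: compacts_def top closedin_compact_space)
    have "limitin H.mtopology \<sigma> L sequentially"
      unfolding H.limit_metric_sequentially
    proof (intro conjI L allI impI)
      fix \<epsilon> :: real assume "\<epsilon> > 0"
      then have \<epsilon>: "\<epsilon> / 3 > 0"
        by simp
      obtain N where N: "\<And>k l. k \<ge> N \<Longrightarrow> l \<ge> N \<Longrightarrow> mdist (hausdorff_metric m) (\<sigma> k) (\<sigma> l) < \<epsilon> / 3"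
        using Cauchy[OF \<epsilon>] by blast
      have "mdist (hausdorff_metric m) (\<sigma> n) L \<le> 2 * (\<epsilon> / 3)" if n: "n \<ge> N" for n
      proof (subst le_iff[OF \<sigma>_in L], intro conjI ballI)
        show "\<exists>x\<in>L. mdist m a x \<le> 2 * (\<epsilon> / 3)" if "a \<in> \<sigma> n" for a
          using near[OF \<epsilon> N n that] .
        fix x assume x: "x \<in> L"
        then obtain k b where k: "k \<ge> N" "b \<in> \<sigma> k" "mdist m x b < \<epsilon> / 3"
          using \<epsilon> unfolding L_def by blast
        then obtain a where a: "a \<in> \<sigma> n" "mdist m a b \<le> \<epsilon> / 3"
          using le_iff[OF \<sigma>_in \<sigma>_in, of n k "\<epsilon> / 3"] N[OF n, of k] by auto
        have "mdist m a x \<le> mdist m a b + mdist m x b"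
          using x \<sigma>_sub[OF a(1)] \<sigma>_sub[OF k(2)] by (intro M.triangle') (auto simp: L_def)
        then show "\<exists>a\<in>\<sigma> n. mdist m a x \<le> 2 * (\<epsilon> / 3)"
          using a k by (intro bexI[of _ a]) linarith+
      qed
      moreover have "2 * (\<epsilon> / 3) < \<epsilon>"
        using \<open>\<epsilon> > 0\<close> by simp
      ultimately have "\<forall>n\<ge>N. \<sigma> n \<in> compacts m \<and> mdist (hausdorff_metric m) (\<sigma> n) L < \<epsilon>"
        using \<sigma>_in by (meson order_le_less_trans)
      then show "\<exists>N. \<forall>n\<ge>N. \<sigma> n \<in> compacts m \<and> mdist (hausdorff_metric m) (\<sigma> n) L < \<epsilon>" ..
    qed
    then show "\<exists>x. limitin H.mtopology \<sigma> x sequentially"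
      by blast
  qed
  ultimately show ?thesis
    by (simp add: top H.compact_space_eq_mcomplete_mtotally_bounded)
qed

lemma hutchinson_compacts:
  assumes "ifs m F" "L \<in> compacts m"
  shows "hutchinson F L \<in> compacts m"
proof -
  have "compactin (mtopology_of m) (f ` L)" if "f \<in> F" for f
    using assms that image_compactin unfolding ifs_def compacts_def by blast
  then have "compactin (mtopology_of m) (\<Union> ((\<lambda>f. f ` L) ` F))"
    using assms(1) by (intro compactin_Union) (auto simp: ifs_def)
  then show ?thesis
    using assms by (auto simp: hutchinson_def compacts_def ifs_def)
qed

lemma ifs_hutchinson:
  assumes F: "ifs m F" and cpt: "compact_space (mtopology_of m)"
  shows "ifs (hausdorff_metric m) {hutchinson F}"
proof -
  have unif: "\<exists>\<delta>>0. \<forall>x\<in>mspace m. \<forall>y\<in>mspace m. mdist m x y < \<delta> \<longrightarrow> mdist m (f x) (f y) < \<epsilon>"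
    if "\<epsilon> > 0" "f \<in> F" for \<epsilon> f
  proof -
    have "uniformly_continuous_map m m f"
      using F that cpt by (simp add: ifs_def continuous_eq_uniformly_continuous_map)
    then show ?thesis
      using that unfolding uniformly_continuous_map_def by (metis mdist_commute)
  qed
  have "uniformly_continuous_map (hausdorff_metric m) (hausdorff_metric m) (hutchinson F)"
    unfolding uniformly_continuous_map_def mspace_hausdorff_metric
  proof (intro conjI allI impI)
    show "hutchinson F \<in> compacts m \<rightarrow> compacts m"
      using hutchinson_compacts[OF F] by blast
    fix \<epsilon> :: real assume "\<epsilon> > 0"
    then have "\<epsilon> / 2 > 0"
      by simp
    then obtain \<delta> where \<delta>: "\<And>f. f \<in> F \<Longrightarrow> \<delta> f > 0"
      "\<And>f x y. f \<in> F \<Longrightarrow> x \<in> mspace m \<Longrightarrow> y \<in> mspace m \<Longrightarrow> mdist m x y < \<delta> f \<Longrightarrow>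
         mdist m (f x) (f y) < \<epsilon> / 2"
      using unif by metis
    define \<eta> where "\<eta> = Min (\<delta> ` F)"
    have fin: "finite F" "F \<noteq> {}"
      using F by (auto simp: ifs_def)
    have \<eta>: "\<eta> > 0" "\<And>f. f \<in> F \<Longrightarrow> \<eta> \<le> \<delta> f"
      using fin \<delta>(1) by (auto simp: \<eta>_def)
    have near: "mdist m (f x) (f y) \<le> \<epsilon> / 2"
      if "f \<in> F" "x \<in> mspace m" "y \<in> mspace m" "mdist m x y < \<eta>" for f x y
      using \<delta>(2)[OF that(1-3)] \<eta>(2)[OF that(1)] that(4) by simp
    have "mdist (hausdorff_metric m) (hutchinson F A) (hutchinson F B) < \<epsilon>"
      if A: "A \<in> compacts m" and B: "B \<in> compacts m"
        and d: "mdist (hausdorff_metric m) A B < \<eta>" for A B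
    proof -
      let ?r = "mdist (hausdorff_metric m) A B"
      have r: "(\<forall>a\<in>A. \<exists>b\<in>B. mdist m a b \<le> ?r) \<and> (\<forall>b\<in>B. \<exists>a\<in>A. mdist m a b \<le> ?r)"
        using hausdorff_dist_le_iff[OF A B, of ?r] by (simp add: mdist_hausdorff_metric[OF A B])
      have "hausdorff_dist m (hutchinson F A) (hutchinson F B) \<le> \<epsilon> / 2"
        unfolding hausdorff_dist_le_iff[OF hutchinson_compacts[OF F A] hutchinson_compacts[OF F B]]
      proof (intro conjI ballI)
        fix p assume "p \<in> hutchinson F A"
        then obtain f a where p: "f \<in> F" "a \<in> A" "p = f a"
          by (auto simp: hutchinson_def)
        then obtain b where b: "b \<in> B" "mdist m a b < \<eta>"
          using r d by force
        have "mdist m p (f b) \<le> \<epsilon> / 2"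
          using near p b compacts_subset[OF A] compacts_subset[OF B] by blast
        then show "\<exists>q\<in>hutchinson F B. mdist m p q \<le> \<epsilon> / 2"
          using p b by (auto simp: hutchinson_def)
      next
        fix q assume "q \<in> hutchinson F B"
        then obtain f b where q: "f \<in> F" "b \<in> B" "q = f b"
          by (auto simp: hutchinson_def)
        then obtain a where a: "a \<in> A" "mdist m a b < \<eta>"
          using r d by force
        have "mdist m (f a) q \<le> \<epsilon> / 2"
          using near q a compacts_subset[OF A] compacts_subset[OF B] by blast
        then show "\<exists>p\<in>hutchinson F A. mdist m p q \<le> \<epsilon> / 2"
          using q a by (auto simp: hutchinson_def)
      qed
      then show ?thesis
        using \<open>\<epsilon> > 0\<close> by (simp add: mdist_hausdorff_metric hutchinson_compacts[OF F] A B)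
    qed
    then show "\<exists>\<delta>>0. \<forall>x\<in>compacts m. \<forall>y\<in>compacts m. mdist (hausdorff_metric m) y x < \<delta> \<longrightarrow>
        mdist (hausdorff_metric m) (hutchinson F y) (hutchinson F x) < \<epsilon>"
      using \<eta>(1) by blast
  qed
  then show ?thesis
    using compact_space_hausdorff_metric[OF cpt]
    by (simp add: ifs_def compact_imp_locally_compact_space uniformly_continuous_imp_continuous_map)
qed


section \<open>The Levitt-Yoccoz gasket\<close>

definition gasket_triangle :: "(real \<times> real) set" where
  "gasket_triangle = convex hull {(0, 0), (1, 0), (1 / 2, sqrt 3 / 2)}"

definition triangle_metric :: "(real \<times> real) metric" where
  "triangle_metric = submetric euclidean_metric gasket_triangle"

definition f_A :: "real \<times> real \<Rightarrow> real \<times> real" where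
  "f_A = (\<lambda>(x, y). (x / (x + y / sqrt 3 + 1), y / (x + y / sqrt 3 + 1)))"

definition f_B :: "real \<times> real \<Rightarrow> real \<times> real" where
  "f_B = (\<lambda>(x, y). ((y / sqrt 3 + 1) / (- x + y / sqrt 3 + 2), y / (- x + y / sqrt 3 + 2)))"

definition f_C :: "real \<times> real \<Rightarrow> real \<times> real" where
  "f_C = (\<lambda>(x, y). ((2 * y / sqrt 3 - 2 * x - 1) / (4 * (y / sqrt 3 - 1)),
                     - sqrt 3 / (4 * (y / sqrt 3 - 1))))"

definition levitt_yoccoz :: "(real \<times> real \<Rightarrow> real \<times> real) set" where
  "levitt_yoccoz = {f_A, f_B, f_C}"

lemma mem_triangle_iff:
  "(x, y) \<in> gasket_triangle \<longleftrightarrow> 0 \<le> y \<and> 0 \<le> x - y / sqrt 3 \<and> x + y / sqrt 3 \<le> 1"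
proof
  assume "(x, y) \<in> gasket_triangle"
  then obtain u v w where uvw: "0 \<le> u" "0 \<le> v" "0 \<le> w" "u + v + w = 1"
    and "(x, y) = u *\<^sub>R (0, 0) + v *\<^sub>R (1, 0) + w *\<^sub>R (1 / 2, sqrt 3 / 2)"
    unfolding gasket_triangle_def convex_hull_3 by blast
  then have x: "x = v + w / 2" and y: "y = w * sqrt 3 / 2"
    by simp_all
  have s: "y / sqrt 3 = w / 2" and "0 \<le> y"
    using uvw by (simp_all add: y)
  then show "0 \<le> y \<and> 0 \<le> x - y / sqrt 3 \<and> x + y / sqrt 3 \<le> 1"
    unfolding s x using uvw by auto
next
  assume *: "0 \<le> y \<and> 0 \<le> x - y / sqrt 3 \<and> x + y / sqrt 3 \<le> 1"
  define s where "s = y / sqrt 3"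
  have y: "y = s * sqrt 3"
    by (simp add: s_def)
  have "0 \<le> s"
    using * by (simp add: s_def)
  then have "(x, y) = (1 - x - s) *\<^sub>R (0, 0) + (x - s) *\<^sub>R (1, 0) + (2 * s) *\<^sub>R (1 / 2, sqrt 3 / 2)
    \<and> 0 \<le> 1 - x - s \<and> 0 \<le> x - s \<and> 0 \<le> 2 * s \<and> (1 - x - s) + (x - s) + 2 * s = 1"
    using * by (simp add: y)
  then show "(x, y) \<in> gasket_triangle"
    unfolding gasket_triangle_def convex_hull_3 by blast
qed

lemma mtopology_of_triangle_metric:
  "mtopology_of triangle_metric = top_of_set gasket_triangle"
  by (simp add: triangle_metric_def mtopology_of_submetric)

lemma mspace_triangle_metric [simp]: "mspace triangle_metric = gasket_triangle"
  by (simp add: triangle_metric_def)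

lemma mdist_triangle_metric [simp]: "mdist triangle_metric = dist"
  by (simp add: triangle_metric_def)

lemma compact_triangle: "compact gasket_triangle"
  unfolding gasket_triangle_def by (intro finite_imp_compact_convex_hull) auto

lemma compact_space_triangle_metric: "compact_space (mtopology_of triangle_metric)"
  using compact_triangle by (simp add: mtopology_of_triangle_metric compact_space_subtopology)

lemma levitt_yoccoz_maps_triangle:
  assumes "f \<in> levitt_yoccoz"
  shows "f ` gasket_triangle \<subseteq> gasket_triangle"
proof
  fix q assume "q \<in> f ` gasket_triangle"
  then obtain x y where xy: "(x, y) \<in> gasket_triangle" and q: "q = f (x, y)"
    by auto
  define s where "s = y / sqrt 3"
  have y: "y = s * sqrt 3"
    by (simp add: s_def)
  have s: "0 \<le> s" "0 \<le> x - s" "x + s \<le> 1"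
    using xy by (auto simp: mem_triangle_iff s_def)
  have tri: "(u, t * sqrt 3) \<in> gasket_triangle \<longleftrightarrow> 0 \<le> t \<and> t \<le> u \<and> u + t \<le> 1" for u t
    by (simp add: mem_triangle_iff zero_le_mult_iff)
  have tri': "(u / D, t / D * sqrt 3) \<in> gasket_triangle"
    if "0 < D" "0 \<le> t" "t \<le> u" "u + t \<le> D" for u t D
    unfolding tri using that by (simp add: divide_right_mono flip: add_divide_distrib)
  have "f (x, y) \<in> gasket_triangle"
  proof -
    consider "f = f_A" | "f = f_B" | "f = f_C"
      using assms by (auto simp: levitt_yoccoz_def)
    then show ?thesis
    proof cases
      case 1
      have "f (x, y) = (x / (x + s + 1), s / (x + s + 1) * sqrt 3)"
        by (simp add: 1 f_A_def y)
      then show ?thesis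
        using tri'[of "x + s + 1" s x] s by simp
    next
      case 2
      have "f (x, y) = ((s + 1) / (- x + s + 2), s / (- x + s + 2) * sqrt 3)"
        by (simp add: 2 f_B_def y)
      then show ?thesis
        using tri'[of "- x + s + 2" s "s + 1"] s by simp
    next
      case 3
      have "f (x, y) = ((2 * s - 2 * x - 1) / (4 * (s - 1)), - 1 / (4 * (s - 1)) * sqrt 3)"
        by (simp add: 3 f_C_def y)
      also have "\<dots> = ((1 + 2 * x - 2 * s) / (4 * (1 - s)), 1 / (4 * (1 - s)) * sqrt 3)"
        using s by (simp add: divide_simps) (simp add: algebra_simps)
      finally show ?thesis
        using tri'[of "4 * (1 - s)" 1 "1 + 2 * x - 2 * s"] s by simp
    qed
  qed
  then show "q \<in> gasket_triangle"
    using q by simp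
qed

lemma continuous_on_levitt_yoccoz:
  assumes "f \<in> levitt_yoccoz"
  shows "continuous_on gasket_triangle f"
proof -
  have *: "fst p + snd p / sqrt 3 + 1 \<noteq> 0" "- fst p + snd p / sqrt 3 + 2 \<noteq> 0"
    "4 * (snd p / sqrt 3 - 1) \<noteq> 0" if "p \<in> gasket_triangle" for p
  proof -
    have bounds: "0 \<le> snd p / sqrt 3" "0 \<le> fst p - snd p / sqrt 3" "fst p + snd p / sqrt 3 \<le> 1"
      using that mem_triangle_iff[of "fst p" "snd p"] by auto
    then have "snd p / sqrt 3 < 1"
      by linarith
    then show "4 * (snd p / sqrt 3 - 1) \<noteq> 0"
      by (simp del: divide_less_eq_1 divide_less_eq_1_pos)
    show "fst p + snd p / sqrt 3 + 1 \<noteq> 0" "- fst p + snd p / sqrt 3 + 2 \<noteq> 0"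
      using bounds by linarith+
  qed
  consider "f = f_A" | "f = f_B" | "f = f_C"
    using assms by (auto simp: levitt_yoccoz_def)
  then show ?thesis
  proof cases
    case 1
    show ?thesis
      unfolding 1 f_A_def case_prod_unfold
      by (intro continuous_intros ballI *; simp)
  next
    case 2
    show ?thesis
      unfolding 2 f_B_def case_prod_unfold
      by (intro continuous_intros ballI *; simp)
  next
    case 3
    show ?thesis
      unfolding 3 f_C_def case_prod_unfold
      by (intro continuous_intros ballI *; simp)
  qed
qed

lemma ifs_levitt_yoccoz: "ifs triangle_metric levitt_yoccoz"
  unfolding ifs_def mtopology_of_triangle_metric
proof (intro conjI ballI)
  show "locally_compact_space (top_of_set gasket_triangle)"
    using compact_space_triangle_metric mtopology_of_triangle_metric
    by (metis compact_imp_locally_compact_space)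
  show "finite levitt_yoccoz" "levitt_yoccoz \<noteq> {}"
    by (auto simp: levitt_yoccoz_def)
  show "continuous_map (top_of_set gasket_triangle) (top_of_set gasket_triangle) f" if "f \<in> levitt_yoccoz" for f
    using continuous_on_levitt_yoccoz[OF that] levitt_yoccoz_maps_triangle[OF that]
    by (auto simp: continuous_map_in_subtopology)
qed

lemma ifs_hutchinson_levitt_yoccoz:
  "ifs (hausdorff_metric triangle_metric) {hutchinson levitt_yoccoz}"
  using ifs_levitt_yoccoz compact_space_triangle_metric by (rule ifs_hutchinson)

end

theory Submission
  imports Defs
begin

text \<open>
  In barycentric coordinates \<open>(a, b, c)\<close> of the triangle the map \<open>f_A\<close> is
  \<open>(1, b, c) / (1 + b + c)\<close>, and \<open>f_B\<close>, \<open>f_C\<close> are obtained by permuting the coordinates.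
  The derivative of each map at its fixed vertex is the identity, so neither these maps nor their
  iterates have a Lipschitz constant below 1 in any norm, and the classical theory of contracting
  systems does not apply. What saves the situation is that a single norm, the \<open>\<ell>\<^sup>1\<close> norm of the
  differences of barycentric coordinates, strictly decreases under all three maps
  (\<open>levitt_yoccoz_decreases_bary_dist\<close>). By compactness the decrease is bounded below on
  the pairs of points that are not close, so the images of the triangle under all long words are
  uniformly small (\<open>strict_contractions_imp_uniform\<close>).

  Everything else follows from this uniform smallness, which is the hypothesis of the locale
  \<open>contracting_ifs\<close>. The hypothesis passes from a system to its Hutchinson map on the
  space of compact subsets (\<open>contracting_ifs_hutchinson\<close>), where the iterates form a Cauchy
  sequence whose limit is the fixed point \<open>K\<close>. A long word sends every point close to
  the image of a point of \<open>K\<close> under the same word, which lies in \<open>K\<close>; this makes \<open>K\<close> the global attractor.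
  A point of \<open>K\<close> is in the image of long words, hence can be reached from everywhere with one
  small jump at the end, so \<open>K\<close> is chain-equivalent. Conversely a chain-recurrent point ends
  arbitrarily long chains, whose last steps are shadowed by an orbit segment
  (\<open>steps_shadowed_by_word\<close>), so the point is close to \<open>K\<close>. The same argument serves
  twice: for the three maps with the set \<open>K\<close>, and for the Hutchinson map with the set \<open>{K}\<close>.
\<close>

section \<open>Words and chains\<close>

lemma word_map_Nil [simp]: "word_map [] = id"
  by (simp add: word_map_def)

lemma word_map_Cons [simp]: "word_map (f # w) = f \<circ> word_map w"
  by (simp add: word_map_def)

lemma word_map_image_hutchinson_power:
  "(hutchinson F ^^ n) L = (\<Union>w\<in>{w \<in> lists F. length w = n}. word_map w ` L)"
proof (induction n)
  case 0
  have "{w \<in> lists F. length w = 0} = {[]}"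
    by auto
  then show ?case
    by simp
next
  case (Suc n)
  show ?case
  proof (intro subset_antisym subsetI)
    fix z assume "z \<in> (hutchinson F ^^ Suc n) L"
    then obtain f w x where "f \<in> F" "w \<in> lists F" "length w = n" "x \<in> L" "z = f (word_map w x)"
      by (auto simp: Suc hutchinson_def)
    then have "f # w \<in> {w \<in> lists F. length w = Suc n}" "z \<in> word_map (f # w) ` L"
      by auto
    then show "z \<in> (\<Union>w\<in>{w \<in> lists F. length w = Suc n}. word_map w ` L)"
      by blast
  next
    fix z assume "z \<in> (\<Union>w\<in>{w \<in> lists F. length w = Suc n}. word_map w ` L)"
    then obtain v x where v: "v \<in> lists F" "length v = Suc n" "x \<in> L" "z = word_map v x"
      by blast
    then obtain f w where "v = f # w"
      by (auto simp: length_Suc_conv)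
    with v have "f \<in> F" "z \<in> f ` (hutchinson F ^^ n) L"
      by (auto simp: Suc)
    then show "z \<in> (hutchinson F ^^ Suc n) L"
      by (auto simp: hutchinson_def)
  qed
qed

lemma hutchinson_singleton [simp]: "hutchinson {g} L = g ` L"
  by (simp add: hutchinson_def)

lemma word_map_singleton:
  assumes "w \<in> lists {g}"
  shows "word_map w = g ^^ length w"
  using assms by (induction w) auto

text \<open>
  Chains with their number of steps recorded. The last step is split off, because the last steps
  of a chain determine where it ends.
\<close>

inductive eps_steps :: "'a metric \<Rightarrow> ('a \<Rightarrow> 'a) set \<Rightarrow> real \<Rightarrow> nat \<Rightarrow> 'a \<Rightarrow> 'a \<Rightarrow> bool"
  for m F \<epsilon> where
  refl: "x \<in> mspace m \<Longrightarrow> eps_steps m F \<epsilon> 0 x x"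
| step: "eps_steps m F \<epsilon> k x y \<Longrightarrow> f \<in> F \<Longrightarrow> z \<in> mspace m \<Longrightarrow> mdist m (f y) z < \<epsilon> \<Longrightarrow>
    eps_steps m F \<epsilon> (Suc k) x z"

lemma eps_steps_trans:
  assumes "eps_steps m F \<epsilon> l y z" "eps_steps m F \<epsilon> k x y"
  shows "eps_steps m F \<epsilon> (k + l) x z"
  using assms by (induction rule: eps_steps.induct) (auto intro: eps_steps.step)

lemma eps_chain_iff_steps: "eps_chain m F \<epsilon> x y \<longleftrightarrow> (\<exists>k. eps_steps m F \<epsilon> k x y)"
proof
  assume "eps_chain m F \<epsilon> x y"
  then obtain k p g where p: "p 0 = x" "p k = y" "\<forall>n\<le>k. p n \<in> mspace m"
    "\<forall>n<k. g n \<in> F \<and> mdist m (g n (p n)) (p (Suc n)) < \<epsilon>"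
    unfolding eps_chain_def by blast
  have "j \<le> k \<Longrightarrow> eps_steps m F \<epsilon> j x (p j)" for j
  proof (induction j)
    case 0
    then show ?case
      using p eps_steps.refl by (metis le0)
  next
    case (Suc j)
    then show ?case
      using p eps_steps.step[of m F \<epsilon> j x "p j" "g j" "p (Suc j)"] by simp
  qed
  then show "\<exists>k. eps_steps m F \<epsilon> k x y"
    using p by blast
next
  assume "\<exists>k. eps_steps m F \<epsilon> k x y"
  then obtain k where "eps_steps m F \<epsilon> k x y" ..
  then have "\<exists>p g. p 0 = x \<and> p k = y \<and> (\<forall>n\<le>k. p n \<in> mspace m) \<and>
      (\<forall>n<k. g n \<in> F \<and> mdist m (g n (p n)) (p (Suc n)) < \<epsilon>)"
  proof induction
    case (refl x)
    then show ?case
      by (intro exI[of _ "\<lambda>_. x"]) auto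
  next
    case (step k x y f z)
    then obtain p g where p: "p 0 = x" "p k = y" "\<forall>n\<le>k. p n \<in> mspace m"
      "\<forall>n<k. g n \<in> F \<and> mdist m (g n (p n)) (p (Suc n)) < \<epsilon>"
      by blast
    then show ?case
      using step.hyps
      by (intro exI[of _ "p(Suc k := z)"] exI[of _ "g(k := f)"]) (auto simp: less_Suc_eq le_Suc_eq)
  qed
  then show "eps_chain m F \<epsilon> x y"
    unfolding eps_chain_def by blast
qed

lemma word_map_in_mspace:
  assumes "ifs m F" "w \<in> lists F" "x \<in> mspace m"
  shows "word_map w x \<in> mspace m"
proof -
  have "f y \<in> mspace m" if "f \<in> F" "y \<in> mspace m" for f y
    using assms(1) that by (auto simp: ifs_def continuous_map_def)
  then show ?thesis
    using assms(2,3) by (induction w) auto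
qed

lemma eps_steps_word_map:
  assumes "ifs m F" "x \<in> mspace m" "0 < \<epsilon>" "w \<in> lists F"
  shows "eps_steps m F \<epsilon> (length w) x (word_map w x)"
  using assms(4)
proof (induction w)
  case Nil
  then show ?case
    using assms(2) by (simp add: eps_steps.refl)
next
  case (Cons f w)
  have "mdist m (word_map (f # w) x) (word_map (f # w) x) = 0"
    using word_map_in_mspace[OF assms(1) _ assms(2), of "f # w"] Cons.hyps Cons.prems by simp
  then show ?case
    using eps_steps.step[of m F \<epsilon> "length w" x "word_map w x" f "word_map (f # w) x"]
      word_map_in_mspace[OF assms(1) _ assms(2), of "f # w"] Cons assms(3)
    by simp
qed


section \<open>Iterated function systems whose long words contract uniformly\<close>

locale contracting_ifs =
  fixes m :: "'a metric" and F :: "('a \<Rightarrow> 'a) set"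
  assumes ifs: "ifs m F"
    and compact_space: "compact_space (mtopology_of m)"
    and contracting: "0 < \<epsilon> \<Longrightarrow> \<exists>n. \<forall>w\<in>lists F. n \<le> length w \<longrightarrow>
      (\<forall>x\<in>mspace m. \<forall>y\<in>mspace m. mdist m (word_map w x) (word_map w y) < \<epsilon>)"
begin

sublocale M: Metric_space "mspace m" "mdist m"
  by (rule Metric_space_mspace_mdist)

text \<open>
  The maps are uniformly continuous as the space is compact, and being finitely many they have a
  common modulus.
\<close>

lemma uniform_modulus:
  assumes "0 < \<epsilon>"
  shows "\<exists>\<delta>>0. \<forall>f\<in>F. \<forall>x\<in>mspace m. \<forall>y\<in>mspace m. mdist m x y < \<delta> \<longrightarrow> mdist m (f x) (f y) < \<epsilon>"
proof -
  have "\<exists>\<delta>>0. \<forall>x\<in>mspace m. \<forall>y\<in>mspace m. mdist m x y < \<delta> \<longrightarrow> mdist m (f x) (f y) < \<epsilon>"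
    if "f \<in> F" for f
  proof -
    have "uniformly_continuous_map m m f"
      using ifs that compact_space by (simp add: ifs_def continuous_eq_uniformly_continuous_map)
    then show ?thesis
      using assms unfolding uniformly_continuous_map_def by (metis mdist_commute)
  qed
  then obtain \<delta> where \<delta>: "\<And>f. f \<in> F \<Longrightarrow> \<delta> f > 0"
    "\<And>f x y. f \<in> F \<Longrightarrow> x \<in> mspace m \<Longrightarrow> y \<in> mspace m \<Longrightarrow> mdist m x y < \<delta> f \<Longrightarrow>
       mdist m (f x) (f y) < \<epsilon>"
    by metis
  have "finite F" "F \<noteq> {}"
    using ifs by (auto simp: ifs_def)
  then show ?thesis
    using \<delta> by (intro exI[of _ "Min (\<delta> ` F)"]) auto
qed

lemma long_words_contract:
  assumes "0 < \<epsilon>"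
  obtains n where "\<And>w x y. \<lbrakk>w \<in> lists F; n \<le> length w; x \<in> mspace m; y \<in> mspace m\<rbrakk> \<Longrightarrow>
    mdist m (word_map w x) (word_map w y) < \<epsilon>"
  using contracting[OF assms] by blast

lemma compacts_point:
  assumes "K \<in> compacts m"
  obtains k where "k \<in> K" "k \<in> mspace m"
  using assms compacts_subset[OF assms] by (auto simp: compacts_def)

text \<open>
  The \<open>k\<close>-th iterate of the Hutchinson map is the union of the images under the words of
  length \<open>k\<close>. Two points with the same word \<open>w\<close>, one coming from \<open>A\<close> and one from
  \<open>B\<close>, are close, which bounds the Hausdorff distance of the two iterates.
\<close>

lemma contracting_ifs_hutchinson: "contracting_ifs (hausdorff_metric m) {hutchinson F}"
proof
  show "ifs (hausdorff_metric m) {hutchinson F}"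
    using ifs compact_space by (rule ifs_hutchinson)
  show "compact_space (mtopology_of (hausdorff_metric m))"
    using compact_space by (rule compact_space_hausdorff_metric)
next
  fix \<epsilon> :: real assume "0 < \<epsilon>"
  then obtain n where n: "\<And>w x y. \<lbrakk>w \<in> lists F; n \<le> length w; x \<in> mspace m; y \<in> mspace m\<rbrakk> \<Longrightarrow>
      mdist m (word_map w x) (word_map w y) < \<epsilon> / 2"
    using long_words_contract[of "\<epsilon> / 2"] by (metis half_gt_zero)
  have "mdist (hausdorff_metric m) ((hutchinson F ^^ k) A) ((hutchinson F ^^ k) B) < \<epsilon>"
    if k: "n \<le> k" and A: "A \<in> compacts m" and B: "B \<in> compacts m" for k A B
  proof -
    have cpt: "(hutchinson F ^^ k) L \<in> compacts m" if "L \<in> compacts m" for L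
      using that by (induction k) (auto intro: hutchinson_compacts[OF ifs])
    have ne: "A \<noteq> {}" "B \<noteq> {}"
      using A B by (auto simp: compacts_def)
    have near: "mdist m (word_map w a) (word_map w b) \<le> \<epsilon> / 2"
      if "w \<in> lists F" "length w = k" "a \<in> A" "b \<in> B" for w a b
      using n[of w a b] k that compacts_subset[OF A] compacts_subset[OF B] by fastforce
    have "hausdorff_dist m ((hutchinson F ^^ k) A) ((hutchinson F ^^ k) B) \<le> \<epsilon> / 2"
      unfolding hausdorff_dist_le_iff[OF cpt[OF A] cpt[OF B]]
      unfolding word_map_image_hutchinson_power
    proof (intro conjI ballI)
      fix p assume "p \<in> (\<Union>w\<in>{w \<in> lists F. length w = k}. word_map w ` A)"
      then show "\<exists>q\<in>\<Union>w\<in>{w \<in> lists F. length w = k}. word_map w ` B. mdist m p q \<le> \<epsilon> / 2"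
        using near ne by blast
    next
      fix q assume "q \<in> (\<Union>w\<in>{w \<in> lists F. length w = k}. word_map w ` B)"
      then show "\<exists>p\<in>\<Union>w\<in>{w \<in> lists F. length w = k}. word_map w ` A. mdist m p q \<le> \<epsilon> / 2"
        using near ne by blast
    qed
    then show ?thesis
      using \<open>0 < \<epsilon>\<close> by (simp add: mdist_hausdorff_metric cpt A B)
  qed
  then show "\<exists>n. \<forall>w\<in>lists {hutchinson F}. n \<le> length w \<longrightarrow>
      (\<forall>A\<in>mspace (hausdorff_metric m). \<forall>B\<in>mspace (hausdorff_metric m).
        mdist (hausdorff_metric m) (word_map w A) (word_map w B) < \<epsilon>)"
    by (intro exI[of _ n]) (simp add: word_map_singleton)
qed

text \<open>
  For a system of one map \<open>g\<close> the contraction hypothesis, applied to \<open>x\<close> and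
  \<open>g\<^sup>k(x)\<close>, says that the iterates of \<open>x\<close> form a Cauchy sequence; its limit is fixed by
  continuity. Applied to the Hutchinson map this gives an invariant compact set.
\<close>

lemma single_map_fixed_point:
  assumes F: "F = {g}" and x: "x \<in> mspace m"
  shows "\<exists>z\<in>mspace m. g z = z"
proof -
  have cont: "continuous_map M.mtopology M.mtopology g"
    using ifs by (simp add: F ifs_def mtopology_of_def)
  have pow: "(g ^^ k) y = word_map (replicate k g) y" for k y
    by (induction k) auto
  have in_space: "(g ^^ k) y \<in> mspace m" if "y \<in> mspace m" for k y
    unfolding pow using ifs that by (intro word_map_in_mspace) (auto simp: F)
  have close: "\<exists>n. \<forall>k\<ge>n. \<forall>y\<in>mspace m. \<forall>z\<in>mspace m. mdist m ((g ^^ k) y) ((g ^^ k) z) < \<epsilon>"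
    if pos: "0 < \<epsilon>" for \<epsilon>
  proof -
    obtain n where n: "\<And>w x y. \<lbrakk>w \<in> lists F; n \<le> length w; x \<in> mspace m; y \<in> mspace m\<rbrakk> \<Longrightarrow>
        mdist m (word_map w x) (word_map w y) < \<epsilon>"
      using long_words_contract[OF pos] by blast
    have "replicate k g \<in> lists F" for k
      by (auto simp: F)
    then show ?thesis
      using n[of "replicate _ g"] unfolding pow by (intro exI[of _ n]) simp
  qed
  have "M.MCauchy (\<lambda>k. (g ^^ k) x)"
    unfolding M.MCauchy_def
  proof (intro conjI allI impI)
    show "range (\<lambda>k. (g ^^ k) x) \<subseteq> mspace m"
      using in_space x by blast
    fix \<epsilon> :: real assume "0 < \<epsilon>"
    then obtain n where n: "\<And>k y z. \<lbrakk>n \<le> k; y \<in> mspace m; z \<in> mspace m\<rbrakk> \<Longrightarrow>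
        mdist m ((g ^^ k) y) ((g ^^ k) z) < \<epsilon>"
      using close by metis
    have "mdist m ((g ^^ i) x) ((g ^^ j) x) < \<epsilon>" if "n \<le> i" "n \<le> j" for i j
    proof -
      have "(g ^^ i) x = (g ^^ n) ((g ^^ (i - n)) x)" "(g ^^ j) x = (g ^^ n) ((g ^^ (j - n)) x)"
        using that by (simp_all flip: funpow_add comp_apply[of "g ^^ n"])
      then show ?thesis
        using n in_space x by simp
    qed
    then show "\<exists>N. \<forall>i j. N \<le> i \<longrightarrow> N \<le> j \<longrightarrow> mdist m ((g ^^ i) x) ((g ^^ j) x) < \<epsilon>"
      by blast
  qed
  moreover have "M.mcomplete"
    using compact_space by (simp add: mtopology_of_def M.compact_space_imp_mcomplete)
  ultimately obtain z where z: "limitin M.mtopology (\<lambda>k. (g ^^ k) x) z sequentially"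
    by (auto simp: M.mcomplete_def)
  then have "limitin M.mtopology (g \<circ> (\<lambda>k. (g ^^ k) x)) (g z) sequentially"
    using continuous_map_limit[OF cont] by blast
  moreover have "limitin M.mtopology (g \<circ> (\<lambda>k. (g ^^ k) x)) z sequentially"
    using limitin_sequentially_offset[OF z, of 1] by (simp add: o_def)
  ultimately have "g z = z"
    by (rule M.limitin_metric_unique) simp
  then show ?thesis
    using z M.limitin_mspace by blast
qed

lemma compact_invariant_exists:
  assumes "mspace m \<noteq> {}"
  shows "\<exists>K\<in>compacts m. hutchinson F K = K"
proof -
  interpret H: contracting_ifs "hausdorff_metric m" "{hutchinson F}"
    by (rule contracting_ifs_hutchinson)
  have "mspace m \<in> compacts m"
    using assms compact_space by (simp add: compacts_def compact_space_def)
  then show ?thesis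
    using H.single_map_fixed_point by simp
qed

lemma invariant_power:
  assumes "hutchinson F L = L" "y \<in> L"
  shows "\<exists>w\<in>lists F. length w = n \<and> y \<in> word_map w ` L"
proof -
  have "(hutchinson F ^^ n) L = L"
    using assms(1) by (induction n) auto
  then show ?thesis
    using assms(2) word_map_image_hutchinson_power[of n F L] by blast
qed

lemma invariant_word_map:
  assumes "hutchinson F L = L" "w \<in> lists F" "x \<in> L"
  shows "word_map w x \<in> L"
  using assms(2)
proof (induction w)
  case (Cons f w)
  then have "f (word_map w x) \<in> hutchinson F L"
    by (auto simp: hutchinson_def)
  then show ?case
    using assms(1) by simp
qed (use assms in simp)

lemma near_compact_imp_mem:
  assumes "K \<in> compacts m" "x \<in> mspace m" "\<And>\<epsilon>. 0 < \<epsilon> \<Longrightarrow> \<exists>y\<in>K. mdist m x y < \<epsilon>"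
  shows "x \<in> K"
proof -
  obtain y where y: "y \<in> K" "\<And>z. z \<in> K \<Longrightarrow> mdist m x y \<le> mdist m x z"
    using compacts_mdist_attained[OF assms(1,2)] by blast
  have "\<not> 0 < mdist m x y"
    using assms(3)[of "mdist m x y"] y(2) by force
  then have "mdist m x y = 0"
    using M.nonneg[of x y] by linarith
  then show ?thesis
    using y(1) assms(2) compacts_subset[OF assms(1)] M.zero by auto
qed

text \<open>
  A point of \<open>S\<close> is the image of another point of \<open>S\<close> under a word as long as desired,
  hence is close to the image in \<open>K\<close> of any point of \<open>K\<close> under the same word.
\<close>

lemma invariant_subset:
  assumes K: "K \<in> compacts m" "hutchinson F K = K"
    and S: "S \<subseteq> mspace m" "hutchinson F S = S"
  shows "S \<subseteq> K"
proof
  fix y assume y: "y \<in> S"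
  obtain k where k: "k \<in> K" "k \<in> mspace m"
    using K(1) by (rule compacts_point)
  show "y \<in> K"
  proof (rule near_compact_imp_mem[OF K(1)])
    show "y \<in> mspace m"
      using y S by blast
    fix \<epsilon> :: real assume "0 < \<epsilon>"
    then obtain n where n: "\<And>w x y. \<lbrakk>w \<in> lists F; n \<le> length w; x \<in> mspace m; y \<in> mspace m\<rbrakk> \<Longrightarrow>
        mdist m (word_map w x) (word_map w y) < \<epsilon>"
      using long_words_contract by blast
    obtain w s where w: "w \<in> lists F" "length w = n" "s \<in> S" "y = word_map w s"
      using invariant_power[OF S(2) y, of n] by blast
    then have "mdist m y (word_map w k) < \<epsilon>"
      using n[of w s k] k S by auto
    then show "\<exists>z\<in>K. mdist m y z < \<epsilon>"
      using invariant_word_map[OF K(2) w(1) k(1)] by blast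
  qed
qed

lemma invariant_unique:
  assumes "K \<in> compacts m" "hutchinson F K = K" "L \<in> compacts m" "hutchinson F L = L"
  shows "L = K"
  using invariant_subset assms compacts_subset by (metis subset_antisym)

lemma global_attractor_iff:
  assumes K: "K \<in> compacts m" "hutchinson F K = K"
  shows "global_attractor m F S \<longleftrightarrow> S = K"
proof
  assume "global_attractor m F S"
  then show "S = K"
    using invariant_unique[OF K] by (auto simp: global_attractor_def H_invariant_def compacts_def)
next
  have "attracts m F K L" if L: "compactin (mtopology_of m) L" for L
    unfolding attracts_def
  proof (intro allI impI)
    fix \<epsilon> :: real assume "0 < \<epsilon>"
    then obtain n where n: "\<And>w x y. \<lbrakk>w \<in> lists F; n \<le> length w; x \<in> mspace m; y \<in> mspace m\<rbrakk> \<Longrightarrow>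
        mdist m (word_map w x) (word_map w y) < \<epsilon>"
      using long_words_contract by blast
    obtain k where k: "k \<in> K" "k \<in> mspace m"
      using K(1) by (rule compacts_point)
    have L: "L \<subseteq> mspace m"
      using compactin_subset_topspace[OF L] by simp
    have "word_map w ` L \<subseteq> nbhd_of m \<epsilon> K" if w: "w \<in> lists F" "Suc n \<le> length w" for w
    proof
      fix q assume "q \<in> word_map w ` L"
      then obtain x where x: "x \<in> L" "q = word_map w x"
        by blast
      then have "mdist m q (word_map w k) < \<epsilon>" "q \<in> mspace m"
        using n[of w x k] k L w word_map_in_mspace[OF ifs w(1)] by auto
      then show "q \<in> nbhd_of m \<epsilon> K"
        using invariant_word_map[OF K(2) w(1) k(1)] by (auto simp: nbhd_of_def)
    qed
    then show "\<exists>\<tau>>0. \<forall>w\<in>lists F. \<tau> \<le> length w \<longrightarrow> word_map w ` L \<subseteq> nbhd_of m \<epsilon> K"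
      by (intro exI[of _ "Suc n"]) simp
  qed
  then show "global_attractor m F S" if "S = K"
    using K that compacts_subset[OF K(1)]
    by (auto simp: global_attractor_def H_invariant_def compacts_def)
qed

text \<open>
  Write \<open>y\<close> as the image of a point of \<open>K\<close> under a long word \<open>w\<close>. The exact orbit
  of \<open>x\<close> along \<open>w\<close> ends close to \<open>y\<close>, so it is enough to allow an error in the
  last step.
\<close>

lemma attractor_downstream:
  assumes K: "K \<in> compacts m" "hutchinson F K = K" and y: "y \<in> K" and x: "x \<in> mspace m"
  shows "downstream m F x y"
  unfolding downstream_def eps_chain_iff_steps
proof (intro allI impI)
  fix \<epsilon> :: real assume "0 < \<epsilon>"
  then obtain n where n: "\<And>w x y. \<lbrakk>w \<in> lists F; n \<le> length w; x \<in> mspace m; y \<in> mspace m\<rbrakk> \<Longrightarrow>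
      mdist m (word_map w x) (word_map w y) < \<epsilon>"
    using long_words_contract by blast
  \<comment> \<open>The word must not be empty, as the error is made while applying its first letter.\<close>
  obtain w k where w: "w \<in> lists F" "length w = Suc n" "k \<in> K" "y = word_map w k"
    using invariant_power[OF K(2) y, of "Suc n"] by blast
  then obtain f v where v: "w = f # v" "f \<in> F" "v \<in> lists F"
    by (cases w) auto
  have "mdist m (f (word_map v x)) y < \<epsilon>"
    using n[of w x k] w v x compacts_subset[OF K(1)] by auto
  then have "eps_steps m F \<epsilon> (Suc (length v)) x y"
    using eps_steps_word_map[OF ifs x \<open>0 < \<epsilon>\<close> v(3)] v(2) y compacts_subset[OF K(1)]
    by (blast intro: eps_steps.step)
  then show "\<exists>k. eps_steps m F \<epsilon> k x y" ..
qed

text \<open>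
  For fixed \<open>n\<close> the errors of the last \<open>n\<close> steps of a chain propagate by uniform continuity
  to an arbitrarily small error at the end, however long the chain is. The point \<open>q\<close> is where
  the chain stands \<open>n\<close> steps before its end.
\<close>

lemma steps_shadowed_by_word:
  assumes "0 < \<eta>"
  shows "\<exists>\<epsilon>>0. \<forall>k x y. n \<le> k \<longrightarrow> eps_steps m F \<epsilon> k x y \<longrightarrow>
    (\<exists>w\<in>lists F. length w = n \<and> (\<exists>q\<in>mspace m. mdist m y (word_map w q) < \<eta>))"
  using assms
proof (induction n arbitrary: \<eta>)
  case 0
  have "y \<in> mspace m" if "eps_steps m F 1 k x y" for k x y
    using that by cases auto
  then show ?case
    using 0 by (intro exI[of _ 1]) force
next
  case (Suc n)
  obtain \<delta> where \<delta>: "\<delta> > 0"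
    "\<And>f x y. \<lbrakk>f \<in> F; x \<in> mspace m; y \<in> mspace m; mdist m x y < \<delta>\<rbrakk> \<Longrightarrow> mdist m (f x) (f y) < \<eta> / 2"
    using uniform_modulus[of "\<eta> / 2"] Suc.prems by auto
  obtain \<epsilon> where \<epsilon>: "\<epsilon> > 0" "\<And>k x y. \<lbrakk>n \<le> k; eps_steps m F \<epsilon> k x y\<rbrakk> \<Longrightarrow>
      \<exists>w\<in>lists F. length w = n \<and> (\<exists>q\<in>mspace m. mdist m y (word_map w q) < \<delta>)"
    using Suc.IH[OF \<delta>(1)] by metis
  have mono: "eps_steps m F \<epsilon> k x y" if "eps_steps m F (min \<epsilon> (\<eta> / 2)) k x y" for k x y
    using that by induction (auto intro: eps_steps.intros)
  have "\<exists>w\<in>lists F. length w = Suc n \<and> (\<exists>q\<in>mspace m. mdist m z (word_map w q) < \<eta>)"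
    if k: "Suc n \<le> k" and steps: "eps_steps m F (min \<epsilon> (\<eta> / 2)) k x z" for k x z
    using steps
  proof cases
    case refl
    then show ?thesis
      using k by simp
  next
    case (step k' y f)
    then obtain w q where w: "w \<in> lists F" "length w = n" "q \<in> mspace m"
      "mdist m y (word_map w q) < \<delta>"
      using \<epsilon>(2)[of k' x y] k mono by auto
    have y: "y \<in> mspace m"
      using step(2) by cases auto
    have wq: "word_map w q \<in> mspace m" "f y \<in> mspace m" "f (word_map w q) \<in> mspace m"
      using word_map_in_mspace[OF ifs, of w q] word_map_in_mspace[OF ifs, of "[f]" y]
        word_map_in_mspace[OF ifs, of "f # w" q] w step y by auto
    have "mdist m (f y) (f (word_map w q)) < \<eta> / 2"
      using \<delta>(2) step w y wq by blast
    then have "mdist m z (f (word_map w q)) < \<eta>"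
      using M.triangle[of z "f y" "f (word_map w q)"] step wq mdist_commute[of m z "f y"] by auto
    then show ?thesis
      using w step by (intro bexI[of _ "f # w"]) auto
  qed
  then show ?case
    using \<epsilon>(1) Suc.prems by (intro exI[of _ "min \<epsilon> (\<eta> / 2)"]) auto
qed

text \<open>
  A chain-recurrent point \<open>x\<close> lies downstream from its image under any word \<open>v\<close>. Going
  first along \<open>v\<close> and then back to \<open>x\<close> gives chains from \<open>x\<close> to itself with at least
  \<open>length v\<close> steps, and the end of a chain with enough steps is close to \<open>K\<close>.
\<close>

lemma chain_recurrent_set_eq:
  assumes K: "K \<in> compacts m" "hutchinson F K = K"
  shows "chain_recurrent_set m F = K"
proof
  show "K \<subseteq> chain_recurrent_set m F"
  proof
    fix x assume x: "x \<in> K"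
    have "orbit_of F x \<subseteq> K"
      using invariant_word_map[OF K(2) _ x] by (auto simp: orbit_of_def)
    then show "x \<in> chain_recurrent_set m F"
      using attractor_downstream[OF K] compacts_subset[OF K(1)] x
      by (auto simp: chain_recurrent_set_def chain_equivalent_def)
  qed
next
  show "chain_recurrent_set m F \<subseteq> K"
  proof
    fix x assume x: "x \<in> chain_recurrent_set m F"
    then have xm: "x \<in> mspace m"
      by (simp add: chain_recurrent_set_def)
    show "x \<in> K"
    proof (rule near_compact_imp_mem[OF K(1) xm])
      fix \<eta> :: real assume "0 < \<eta>"
      then have \<eta>2: "0 < \<eta> / 2"
        by simp
      obtain n where n: "\<And>w x y. \<lbrakk>w \<in> lists F; n \<le> length w; x \<in> mspace m; y \<in> mspace m\<rbrakk> \<Longrightarrow>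
          mdist m (word_map w x) (word_map w y) < \<eta> / 2"
        using long_words_contract[OF \<eta>2] by blast
      obtain \<epsilon> where \<epsilon>: "\<epsilon> > 0" "\<And>k x y. \<lbrakk>n \<le> k; eps_steps m F \<epsilon> k x y\<rbrakk> \<Longrightarrow>
          \<exists>w\<in>lists F. length w = n \<and> (\<exists>q\<in>mspace m. mdist m y (word_map w q) < \<eta> / 2)"
        using steps_shadowed_by_word[OF \<eta>2, of n] by metis
      obtain f where f: "f \<in> F"
        using ifs by (auto simp: ifs_def)
      define v where "v = replicate n f"
      have v: "v \<in> lists F" "length v = n"
        using f by (auto simp: v_def)
      then have "downstream m F (word_map v x) x"
        using x by (auto simp: chain_recurrent_set_def orbit_of_def chain_equivalent_def)
      then obtain l where "eps_steps m F \<epsilon> l (word_map v x) x"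
        using \<epsilon>(1) by (auto simp: downstream_def eps_chain_iff_steps)
      then have "eps_steps m F \<epsilon> (n + l) x x"
        using eps_steps_trans eps_steps_word_map[OF ifs xm \<epsilon>(1) v(1)] v(2) by metis
      then obtain w q where w: "w \<in> lists F" "length w = n" "q \<in> mspace m"
        "mdist m x (word_map w q) < \<eta> / 2"
        using \<epsilon>(2)[of "n + l" x x] by auto
      obtain k where k: "k \<in> K" "k \<in> mspace m"
        using K(1) by (rule compacts_point)
      have "mdist m x (word_map w k) < \<eta>"
        using M.triangle[of x "word_map w q" "word_map w k"] n[of w q k] w k xm
          word_map_in_mspace[OF ifs w(1)] by fastforce
      then show "\<exists>y\<in>K. mdist m x y < \<eta>"
        using invariant_word_map[OF K(2) w(1) k(1)] by blast
    qed
  qed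
qed

lemma chain_equivalent_attractor:
  assumes "K \<in> compacts m" "hutchinson F K = K"
  shows "chain_equivalent_set m F K"
  using attractor_downstream[OF assms] compacts_subset[OF assms(1)]
  by (auto simp: chain_equivalent_set_def chain_equivalent_def)

lemma chain_nodes_eq:
  assumes K: "K \<in> compacts m" "hutchinson F K = K"
  shows "chain_nodes m F = {K}"
proof -
  have "{(x, y). x \<in> K \<and> y \<in> K \<and> chain_equivalent m F x y} = K \<times> K"
    using chain_equivalent_attractor[OF K] by (auto simp: chain_equivalent_set_def)
  moreover have "K \<noteq> {}"
    using K by (simp add: compacts_def)
  ultimately show ?thesis
    unfolding chain_nodes_def chain_recurrent_set_eq[OF K] by (auto simp: quotient_def)
qed

lemma chain_graph_eq:
  assumes "K \<in> compacts m" "hutchinson F K = K"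
  shows "chain_graph m F = \<lparr>pverts = {K}, parcs = {}\<rparr>"
  by (auto simp: chain_graph_def chain_nodes_eq[OF assms])

end


section \<open>Strictly distance-decreasing maps of a compact set\<close>

text \<open>
  On the pairs with \<open>d x y \<ge> \<eta>\<close>, a compact set, every map lowers \<open>d\<close> by at least some
  constant \<open>\<gamma> > 0\<close>. As \<open>d\<close> never increases along a word, it either falls below
  \<open>\<eta>\<close> and stays there, or loses \<open>\<gamma>\<close> at each letter; the latter cannot last longer
  than \<open>D / \<gamma>\<close> letters if \<open>D\<close> bounds \<open>d\<close>. Finally \<open>\<eta>\<close> is chosen so small that
  \<open>d x y < \<eta>\<close> forces \<open>dist x y < \<epsilon>\<close>. The function \<open>d\<close> may differ from the
  distance, since the maps may fail to decrease the latter.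
\<close>

lemma strict_contractions_imp_uniform:
  fixes X :: "'a::metric_space set" and d :: "'a \<Rightarrow> 'a \<Rightarrow> real"
  assumes X: "compact X" and fin: "finite F"
    and maps: "\<And>f. f \<in> F \<Longrightarrow> f ` X \<subseteq> X"
    and cont: "\<And>f. f \<in> F \<Longrightarrow> continuous_on X f"
    and d: "continuous_on (X \<times> X) (\<lambda>(x, y). d x y)" "\<And>x. x \<in> X \<Longrightarrow> d x x = 0"
      "\<And>x y. \<lbrakk>x \<in> X; y \<in> X; x \<noteq> y\<rbrakk> \<Longrightarrow> 0 < d x y"
    and less: "\<And>f x y. \<lbrakk>f \<in> F; x \<in> X; y \<in> X; x \<noteq> y\<rbrakk> \<Longrightarrow> d (f x) (f y) < d x y"
    and \<epsilon>: "0 < \<epsilon>"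
  shows "\<exists>n. \<forall>w\<in>lists F. n \<le> length w \<longrightarrow> (\<forall>x\<in>X. \<forall>y\<in>X. dist (word_map w x) (word_map w y) < \<epsilon>)"
proof -
  let ?d = "\<lambda>z. d (fst z) (snd z)"
  have d': "continuous_on (X \<times> X) ?d"
    using d(1) by (simp add: case_prod_unfold)
  have XX: "compact (X \<times> X)" "closed (X \<times> X)"
    using X by (simp_all add: compact_Times compact_imp_closed)
  have nonneg: "0 \<le> d x y" if "x \<in> X" "y \<in> X" for x y
    using d(2,3) that by (metis less_eq_real_def)
  have mono: "d (f x) (f y) \<le> d x y" if "f \<in> F" "x \<in> X" "y \<in> X" for f x y
    using less[OF that] d(2) maps[OF that(1)] that by (cases "x = y") auto
  have in_X: "word_map w x \<in> X" if "w \<in> lists F" "x \<in> X" for w x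
    using that maps by (induction w) auto

  obtain \<eta> where \<eta>: "0 < \<eta>" "\<And>x y. \<lbrakk>x \<in> X; y \<in> X; d x y < \<eta>\<rbrakk> \<Longrightarrow> dist x y < \<epsilon>"
  proof -
    let ?P = "(X \<times> X) \<inter> {z. \<epsilon> \<le> dist (fst z) (snd z)}"
    have "compact ?P"
      using XX(1) by (intro compact_Int_closed closed_Collect_le continuous_intros)
    have "\<exists>\<eta>>0. \<forall>z\<in>?P. \<eta> \<le> ?d z"
    proof (cases "?P = {}")
      case True
      then show ?thesis
        by (metis empty_iff zero_less_one)
    next
      case False
      have "continuous_on ?P ?d"
        by (rule continuous_on_subset[OF d']) auto
      from continuous_attains_inf[OF \<open>compact ?P\<close> False this]
      obtain z where z: "z \<in> ?P" "\<forall>u\<in>?P. ?d z \<le> ?d u"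
        by blast
      moreover have "0 < ?d z"
        using z(1) \<epsilon> by (intro d(3)) auto
      ultimately show ?thesis
        by blast
    qed
    then obtain \<eta> where "0 < \<eta>" "\<forall>z\<in>?P. \<eta> \<le> ?d z"
      by blast
    then show thesis
      by (intro that[of \<eta>]) (force simp: not_le[symmetric])+
  qed

  have drop: "\<exists>c>0. \<forall>x\<in>X. \<forall>y\<in>X. \<eta> \<le> d x y \<longrightarrow> d (f x) (f y) + c \<le> d x y" if f: "f \<in> F" for f
  proof -
    let ?Q = "(X \<times> X) \<inter> ?d -` {\<eta>..}"
    let ?g = "\<lambda>z. ?d z - ?d (f (fst z), f (snd z))"
    have "closed ?Q"
      using d' XX(2) by (intro continuous_closed_preimage) auto
    then have "compact ?Q"
      using XX(1) by (metis compact_Int_closed inf.left_idem)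
    have "continuous_on (X \<times> X) (\<lambda>z. (f (fst z), f (snd z)))"
      by (intro continuous_intros continuous_on_compose2[OF cont[OF f]]) auto
    then have "continuous_on (X \<times> X) (\<lambda>z. ?d (f (fst z), f (snd z)))"
      by (rule continuous_on_compose2[OF d']) (use maps[OF f] in auto)
    then have cont_g: "continuous_on ?Q ?g"
      by (intro continuous_on_subset[OF continuous_on_diff[OF d']]) auto
    have "\<exists>c>0. \<forall>z\<in>?Q. c \<le> ?g z"
    proof (cases "?Q = {}")
      case True
      then show ?thesis
        by (metis empty_iff zero_less_one)
    next
      case False
      from continuous_attains_inf[OF \<open>compact ?Q\<close> False cont_g]
      obtain z where z: "z \<in> ?Q" "\<forall>u\<in>?Q. ?g z \<le> ?g u"
        by blast
      moreover have "0 < ?g z"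
        using z(1) \<eta>(1) d(2) less[OF f, of "fst z" "snd z"] by (cases "fst z = snd z") auto
      ultimately show ?thesis
        by blast
    qed
    then obtain c where c: "0 < c" "\<forall>z\<in>?Q. c \<le> ?g z"
      by blast
    have "d (f x) (f y) + c \<le> d x y" if "x \<in> X" "y \<in> X" "\<eta> \<le> d x y" for x y
      using bspec[OF c(2), of "(x, y)"] that by simp
    then show ?thesis
      using c(1) by blast
  qed
  then obtain c where c: "\<And>f. f \<in> F \<Longrightarrow> 0 < c f"
    "\<And>f x y. \<lbrakk>f \<in> F; x \<in> X; y \<in> X; \<eta> \<le> d x y\<rbrakk> \<Longrightarrow> d (f x) (f y) + c f \<le> d x y"
    by metis
  define \<gamma> where "\<gamma> = Min (insert 1 (c ` F))"
  have \<gamma>: "0 < \<gamma>" "\<And>f. f \<in> F \<Longrightarrow> \<gamma> \<le> c f"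
    using fin c(1) by (auto simp: \<gamma>_def)

  have word: "d (word_map w x) (word_map w y) < \<eta> \<or>
      d (word_map w x) (word_map w y) + length w * \<gamma> \<le> d x y"
    if "w \<in> lists F" "x \<in> X" "y \<in> X" for w x y
    using that(1)
  proof (induction w)
    case (Cons f w)
    let ?u = "word_map w x" and ?v = "word_map w y"
    have uv: "?u \<in> X" "?v \<in> X"
      using in_X Cons.hyps that by auto
    show ?case
    proof (cases "d ?u ?v < \<eta>")
      case True
      then show ?thesis
        using mono[OF Cons.hyps(1) uv] by simp
    next
      case False
      then show ?thesis
        using c(2)[OF Cons.hyps(1) uv] \<gamma>(2)[OF Cons.hyps(1)] Cons.IH by (simp add: algebra_simps)
    qed
  qed simp

  obtain D where D: "\<And>x y. x \<in> X \<Longrightarrow> y \<in> X \<Longrightarrow> d x y \<le> D"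
  proof -
    have "bounded (?d ` (X \<times> X))"
      using compact_continuous_image[OF d' XX(1)] by (rule compact_imp_bounded)
    then obtain D where "\<forall>z\<in>X \<times> X. \<bar>?d z\<bar> \<le> D"
      by (auto simp: bounded_iff)
    then show thesis
      by (intro that[of D]) fastforce
  qed
  obtain n :: nat where n: "D < n * \<gamma>"
    using reals_Archimedean3[OF \<gamma>(1)] by blast
  have "dist (word_map w x) (word_map w y) < \<epsilon>"
    if w: "w \<in> lists F" "n \<le> length w" and xy: "x \<in> X" "y \<in> X" for w x y
  proof (rule \<eta>(2)[OF in_X[OF w(1) xy(1)] in_X[OF w(1) xy(2)]])
    have "n * \<gamma> \<le> length w * \<gamma>"
      using w(2) \<gamma>(1) by simp
    then show "d (word_map w x) (word_map w y) < \<eta>"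
      using word[OF w(1) xy] D[OF xy] n nonneg[OF in_X[OF w(1) xy(1)] in_X[OF w(1) xy(2)]] by linarith
  qed
  then show ?thesis
    by blast
qed


section \<open>The gasket maps in barycentric coordinates\<close>

definition barycentric :: "real \<times> real \<Rightarrow> real \<times> real \<times> real" where
  "barycentric = (\<lambda>(x, y). (1 - x - y / sqrt 3, x - y / sqrt 3, 2 * (y / sqrt 3)))"

lemma barycentric_triangle:
  assumes "p \<in> gasket_triangle"
  obtains a b c where "barycentric p = (a, b, c)" "0 \<le> a" "0 \<le> b" "0 \<le> c" "a + b + c = 1"
  using assms by (cases p) (auto simp: barycentric_def mem_triangle_iff)

lemma barycentric_inject: "barycentric p = barycentric q \<longleftrightarrow> p = q"
  by (cases p; cases q) (auto simp: barycentric_def)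

text \<open>
  Writing the ordinate as a multiple of \<open>sqrt 3\<close> removes the square roots from all the formulas.
\<close>

lemma barycentric_scaled: "barycentric (x, t * sqrt 3) = (1 - x - t, x - t, 2 * t)"
  by (simp add: barycentric_def)

lemma barycentric_f_A:
  assumes "barycentric p = (a, b, c)" "1 + b + c \<noteq> 0"
  shows "barycentric (f_A p) = (1 / (1 + b + c), b / (1 + b + c), c / (1 + b + c))"
proof -
  obtain x t where p: "p = (x, t * sqrt 3)"
    by (metis nonzero_eq_divide_eq real_sqrt_eq_zero_cancel_iff surj_pair zero_neq_numeral)
  have abc: "a = 1 - x - t" "b = x - t" "c = 2 * t"
    using assms(1) by (simp_all add: barycentric_scaled p)
  have "f_A p = (x / (1 + b + c), t / (1 + b + c) * sqrt 3)"
    by (simp add: f_A_def p abc algebra_simps)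
  then show ?thesis
    using assms(2) by (simp only: barycentric_scaled) (simp add: divide_simps, simp add: abc)
qed

lemma barycentric_f_B:
  assumes "barycentric p = (a, b, c)" "1 + a + c \<noteq> 0"
  shows "barycentric (f_B p) = (a / (1 + a + c), 1 / (1 + a + c), c / (1 + a + c))"
proof -
  obtain x t where p: "p = (x, t * sqrt 3)"
    by (metis nonzero_eq_divide_eq real_sqrt_eq_zero_cancel_iff surj_pair zero_neq_numeral)
  have abc: "a = 1 - x - t" "b = x - t" "c = 2 * t"
    using assms(1) by (simp_all add: barycentric_scaled p)
  have "f_B p = ((t + 1) / (1 + a + c), t / (1 + a + c) * sqrt 3)"
    by (simp add: f_B_def p abc algebra_simps)
  then show ?thesis
    using assms(2) by (simp only: barycentric_scaled) (simp add: divide_simps, simp add: abc)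
qed

lemma barycentric_f_C:
  assumes "barycentric p = (a, b, c)" "1 + a + b \<noteq> 0"
  shows "barycentric (f_C p) = (a / (1 + a + b), b / (1 + a + b), 1 / (1 + a + b))"
proof -
  obtain x t where p: "p = (x, t * sqrt 3)"
    by (metis nonzero_eq_divide_eq real_sqrt_eq_zero_cancel_iff surj_pair zero_neq_numeral)
  have abc: "a = 1 - x - t" "b = x - t" "c = 2 * t"
    using assms(1) by (simp_all add: barycentric_scaled p)
  have "f_C p = ((2 * t - 2 * x - 1) / (4 * (t - 1)), - 1 / (4 * (t - 1)) * sqrt 3)"
    by (simp add: f_C_def p)
  moreover have "4 * (t - 1) = - (2 * (1 + a + b))"
    by (simp add: abc)
  ultimately have "f_C p = ((2 * t - 2 * x - 1) / - (2 * (1 + a + b)), - 1 / - (2 * (1 + a + b)) * sqrt 3)"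
    by (simp only:)
  then show ?thesis
    using assms(2)
    by (simp only: barycentric_scaled) (simp add: divide_simps, simp add: abc algebra_simps)
qed

definition bary_dist :: "real \<times> real \<Rightarrow> real \<times> real \<Rightarrow> real" where
  "bary_dist p q = (case (barycentric p, barycentric q) of
     ((a, b, c), (a', b', c')) \<Rightarrow> \<bar>a - a'\<bar> + \<bar>b - b'\<bar> + \<bar>c - c'\<bar>)"

text \<open>
  This is the central estimate. Put \<open>s = b + c\<close> and \<open>D = (1 + s) (1 + s')\<close>. The first
  coordinate contributes \<open>\<bar>s - s'\<bar> / D \<le> \<bar>s - s'\<bar>\<close>. The other two contribute at most
  \<open>(\<bar>b - b'\<bar> (1 + c + c') + \<bar>c - c'\<bar> (1 + b + b')) / D\<close>, where
  \<open>D \<ge> 1 + b + b' + c + c'\<close>. The bound on \<open>D\<close> makes this strictly smaller than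
  \<open>\<bar>b - b'\<bar> + \<bar>c - c'\<bar>\<close>: if \<open>b \<noteq> b'\<close> then \<open>b + b' > 0\<close>, and likewise
  for \<open>c\<close>.
\<close>

lemma parabolic_map_decreases_l1:
  fixes b c b' c' :: real
  assumes nonneg: "0 \<le> b" "0 \<le> c" "0 \<le> b'" "0 \<le> c'" and ne: "(b, c) \<noteq> (b', c')"
  shows "\<bar>1 / (1 + b + c) - 1 / (1 + b' + c')\<bar> + \<bar>b / (1 + b + c) - b' / (1 + b' + c')\<bar>
      + \<bar>c / (1 + b + c) - c' / (1 + b' + c')\<bar>
    < \<bar>(b + c) - (b' + c')\<bar> + \<bar>b - b'\<bar> + \<bar>c - c'\<bar>"
proof -
  define D where "D = (1 + b + c) * (1 + b' + c')"
  have pos: "1 + b + c > 0" "1 + b' + c' > 0"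
    using nonneg by linarith+
  have D1: "1 \<le> D" and D_ge: "1 + b + b' + c + c' \<le> D"
    using nonneg by (simp_all add: D_def algebra_simps)
  have diff: "u / (1 + b + c) - v / (1 + b' + c') = (u * (1 + b' + c') - v * (1 + b + c)) / D" for u v
    using pos by (simp add: D_def divide_simps)
  \<comment> \<open>The determinant \<open>b c' - b' c\<close> is expanded symmetrically in the two points: then
    the sum of the bounds has the coefficients \<open>1 + c + c'\<close> and \<open>1 + b + b'\<close>, both at most \<open>D\<close>.\<close>
  have num_b: "b * (1 + b' + c') - b' * (1 + b + c) =
      (b - b') * (1 + (c + c') / 2) - (c - c') * ((b + b') / 2)"
    and num_c: "c * (1 + b' + c') - c' * (1 + b + c) =
      (c - c') * (1 + (b + b') / 2) - (b - b') * ((c + c') / 2)"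
    by (simp_all add: field_simps)
  have "\<bar>(b - b') * (1 + (c + c') / 2) - (c - c') * ((b + b') / 2)\<bar>
      \<le> \<bar>b - b'\<bar> * (1 + (c + c') / 2) + \<bar>c - c'\<bar> * ((b + b') / 2)"
    using nonneg abs_triangle_ineq4[of "(b - b') * (1 + (c + c') / 2)" "(c - c') * ((b + b') / 2)"]
    by (simp add: abs_mult)
  moreover have "\<bar>(c - c') * (1 + (b + b') / 2) - (b - b') * ((c + c') / 2)\<bar>
      \<le> \<bar>c - c'\<bar> * (1 + (b + b') / 2) + \<bar>b - b'\<bar> * ((c + c') / 2)"
    using nonneg abs_triangle_ineq4[of "(c - c') * (1 + (b + b') / 2)" "(b - b') * ((c + c') / 2)"]
    by (simp add: abs_mult)
  moreover have "\<bar>b - b'\<bar> * (1 + (c + c') / 2) + \<bar>c - c'\<bar> * ((b + b') / 2)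
      + (\<bar>c - c'\<bar> * (1 + (b + b') / 2) + \<bar>b - b'\<bar> * ((c + c') / 2))
    = \<bar>b - b'\<bar> * (1 + c + c') + \<bar>c - c'\<bar> * (1 + b + b')"
    by (simp add: field_simps)
  moreover have "\<bar>b - b'\<bar> * (1 + c + c') + \<bar>c - c'\<bar> * (1 + b + b') < (\<bar>b - b'\<bar> + \<bar>c - c'\<bar>) * D"
  proof -
    have le: "\<bar>b - b'\<bar> * (1 + c + c') \<le> \<bar>b - b'\<bar> * D" "\<bar>c - c'\<bar> * (1 + b + b') \<le> \<bar>c - c'\<bar> * D"
      using D_ge nonneg by (auto intro!: mult_left_mono)
    show ?thesis
    proof (cases "b = b'")
      case True
      then have "\<bar>c - c'\<bar> * (1 + b + b') < \<bar>c - c'\<bar> * D"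
        using D_ge nonneg ne by (intro mult_strict_left_mono) auto
      then show ?thesis
        using True by simp
    next
      case False
      then have "\<bar>b - b'\<bar> * (1 + c + c') < \<bar>b - b'\<bar> * D"
        using D_ge nonneg by (intro mult_strict_left_mono) auto
      then show ?thesis
        using le(2) by (simp only: distrib_right)
    qed
  qed
  ultimately have "\<bar>b * (1 + b' + c') - b' * (1 + b + c)\<bar> + \<bar>c * (1 + b' + c') - c' * (1 + b + c)\<bar>
      < (\<bar>b - b'\<bar> + \<bar>c - c'\<bar>) * D"
    unfolding num_b num_c by linarith
  moreover have "\<bar>1 * (1 + b' + c') - 1 * (1 + b + c)\<bar> \<le> \<bar>(b + c) - (b' + c')\<bar> * D"
  proof -
    have "1 * (1 + b' + c') - 1 * (1 + b + c) = - ((b + c) - (b' + c'))"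
      by simp
    then show ?thesis
      using mult_left_mono[OF D1, of "\<bar>(b + c) - (b' + c')\<bar>"] by (simp only: abs_minus_cancel) simp
  qed
  ultimately show ?thesis
    unfolding diff abs_divide using D1 by (simp add: field_simps)
qed

lemma levitt_yoccoz_decreases_bary_dist:
  assumes f: "f \<in> levitt_yoccoz" and pq: "p \<in> gasket_triangle" "q \<in> gasket_triangle" "p \<noteq> q"
  shows "bary_dist (f p) (f q) < bary_dist p q"
proof -
  obtain a b c where p: "barycentric p = (a, b, c)" "0 \<le> a" "0 \<le> b" "0 \<le> c" "a + b + c = 1"
    using pq(1) by (rule barycentric_triangle)
  obtain a' b' c' where q: "barycentric q = (a', b', c')" "0 \<le> a'" "0 \<le> b'" "0 \<le> c'" "a' + b' + c' = 1"
    using pq(2) by (rule barycentric_triangle)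
  have ne: "(a, b, c) \<noteq> (a', b', c')"
    using barycentric_inject pq(3) p(1) q(1) by metis
  consider "f = f_A" | "f = f_B" | "f = f_C"
    using f by (auto simp: levitt_yoccoz_def)
  then show ?thesis
  proof cases
    case 1
    have "(b, c) \<noteq> (b', c')"
      using ne p q by auto
    moreover have "\<bar>(b + c) - (b' + c')\<bar> = \<bar>a - a'\<bar>"
      using p q by linarith
    ultimately show ?thesis
      using parabolic_map_decreases_l1[of b c b' c'] p q
      by (simp add: 1 bary_dist_def barycentric_f_A)
  next
    case 2
    have "(a, c) \<noteq> (a', c')"
      using ne p q by auto
    moreover have "\<bar>(a + c) - (a' + c')\<bar> = \<bar>b - b'\<bar>"
      using p q by linarith
    ultimately show ?thesis
      using parabolic_map_decreases_l1[of a c a' c'] p q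
      by (simp add: 2 bary_dist_def barycentric_f_B)
  next
    case 3
    have "(a, b) \<noteq> (a', b')"
      using ne p q by auto
    moreover have "\<bar>(a + b) - (a' + b')\<bar> = \<bar>c - c'\<bar>"
      using p q by linarith
    ultimately show ?thesis
      using parabolic_map_decreases_l1[of a b a' b'] p q
      by (simp add: 3 bary_dist_def barycentric_f_C)
  qed
qed

lemma contracting_ifs_levitt_yoccoz: "contracting_ifs triangle_metric levitt_yoccoz"
proof
  show "ifs triangle_metric levitt_yoccoz"
    by (rule ifs_levitt_yoccoz)
  show "compact_space (mtopology_of triangle_metric)"
    by (rule compact_space_triangle_metric)
  fix \<epsilon> :: real assume "0 < \<epsilon>"
  have "continuous_on (gasket_triangle \<times> gasket_triangle) (\<lambda>(p, q). bary_dist p q)"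
    unfolding bary_dist_def barycentric_def case_prod_unfold prod.sel
    by (intro continuous_intros) auto
  moreover have "0 < bary_dist p q" if "p \<noteq> q" for p q
  proof -
    obtain a b c a' b' c' where *: "barycentric p = (a, b, c)" "barycentric q = (a', b', c')"
      by (metis prod_cases3)
    then have "(a, b, c) \<noteq> (a', b', c')"
      using barycentric_inject that by metis
    then show ?thesis
      by (auto simp: bary_dist_def *)
  qed
  moreover have "bary_dist p p = 0" for p
    by (simp add: bary_dist_def split: prod.split)
  moreover have "finite levitt_yoccoz"
    by (simp add: levitt_yoccoz_def)
  ultimately have "\<exists>n. \<forall>w\<in>lists levitt_yoccoz. n \<le> length w \<longrightarrow>
      (\<forall>p\<in>gasket_triangle. \<forall>q\<in>gasket_triangle. dist (word_map w p) (word_map w q) < \<epsilon>)"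
    by (intro strict_contractions_imp_uniform[where d = bary_dist] compact_triangle
        levitt_yoccoz_maps_triangle continuous_on_levitt_yoccoz levitt_yoccoz_decreases_bary_dist
        \<open>0 < \<epsilon>\<close>)
  then show "\<exists>n. \<forall>w\<in>lists levitt_yoccoz. n \<le> length w \<longrightarrow>
      (\<forall>p\<in>mspace triangle_metric. \<forall>q\<in>mspace triangle_metric.
        mdist triangle_metric (word_map w p) (word_map w q) < \<epsilon>)"
    by simp
qed

theorem theorem6:
  shows "\<exists>K.
    (K \<in> compacts triangle_metric \<and> hutchinson levitt_yoccoz K = K \<and>
     (\<forall>L\<in>compacts triangle_metric. hutchinson levitt_yoccoz L = L \<longrightarrow> L = K)) \<and>
    (\<forall>S. global_attractor (hausdorff_metric triangle_metric) {hutchinson levitt_yoccoz} S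
           \<longleftrightarrow> S = {K}) \<and>
    chain_recurrent_set (hausdorff_metric triangle_metric) {hutchinson levitt_yoccoz} = {K} \<and>
    (\<forall>S. global_attractor triangle_metric levitt_yoccoz S \<longleftrightarrow> S = K) \<and>
    chain_recurrent_set triangle_metric levitt_yoccoz = K \<and>
    chain_equivalent_set triangle_metric levitt_yoccoz K \<and>
    chain_nodes triangle_metric levitt_yoccoz = {K} \<and>
    chain_graph triangle_metric levitt_yoccoz = \<lparr>pverts = {K}, parcs = {}\<rparr> \<and>
    chain_graph (hausdorff_metric triangle_metric) {hutchinson levitt_yoccoz} =
      \<lparr>pverts = {{K}}, parcs = {}\<rparr>"
proof -
  interpret F: contracting_ifs triangle_metric levitt_yoccoz
    by (rule contracting_ifs_levitt_yoccoz)
  interpret H: contracting_ifs "hausdorff_metric triangle_metric" "{hutchinson levitt_yoccoz}"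
    by (rule F.contracting_ifs_hutchinson)
  have "gasket_triangle \<noteq> {}"
    by (simp add: gasket_triangle_def)
  then obtain K where K: "K \<in> compacts triangle_metric" "hutchinson levitt_yoccoz K = K"
    using F.compact_invariant_exists by auto
  have "{K} \<in> compacts (hausdorff_metric triangle_metric)"
    using K(1) by (auto simp: compacts_def[of "hausdorff_metric triangle_metric"])
  then have K': "{K} \<in> compacts (hausdorff_metric triangle_metric)"
    "hutchinson {hutchinson levitt_yoccoz} {K} = {K}"
    using K(2) by simp_all
  have unique: "\<forall>L\<in>compacts triangle_metric. hutchinson levitt_yoccoz L = L \<longrightarrow> L = K"
    using F.invariant_unique[OF K] by blast
  show ?thesis
    by (intro exI[of _ K] conjI allI K unique H.global_attractor_iff[OF K'] H.chain_recurrent_set_eq[OF K']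
        F.global_attractor_iff[OF K] F.chain_recurrent_set_eq[OF K] F.chain_equivalent_attractor[OF K]
        F.chain_nodes_eq[OF K] F.chain_graph_eq[OF K] H.chain_graph_eq[OF K'])
qed

end
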